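(* Let $\mu,\nu$ be partitions, let $l=l(\mu)$, let $p$ be a positive integer, and let $\lambda=(0,\dots,0,p)$ be of length $e+1$, where $1\le e<l-1$. Let $c^{\nu}_{\lambda\mu}(a)\in\mathbb{Z}[a]$ be the coefficients defined by $h_{p,e}\,s_\mu(x|\!|a)=\sum_\nu c^{\nu}_{\lambda\mu}(a)\,s_\nu(x|\!|a)$. If $\mu\not\subseteq\nu$, then $c^{\nu}_{\lambda\mu}(a)=0$. Otherwise $$c^{\nu}_{\lambda\mu}(a)=\sum_{T}\ \prod_{\substack{\alpha\in\lambda\\ T(\alpha)\ \text{unbarred}}}\left(a_{T(\alpha)-\rho(\alpha)_{T(\alpha)}}-a_{T(\alpha)-c(\alpha)}\right),$$ summed over all reverse $\lambda$-tableaux $T$ whose row word $S^r$ takes $\mu$ to $\nu$ and is Yamanouchi when applied to $\mu$, where $\rho(\alpha)$ is the composition created from $\mu$ using $S^r(\alpha)$. The sum is understood coefficientwise: each product is expanded into its signed monomials in the $a_i$ (choosing one of the two terms of each factor), and each monomial receives finitely many such contributions in total.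
   Context: **Compositions and diagrams.** An integer vector is a sequence of integers with finitely many nonzero entries; its length $l(\cdot)$ is the index of its rightmost nonzero entry. A composition is an integer vector with nonnegative entries; a partition is a composition with weakly decreasing entries. Write $\alpha\supseteq\beta$ if $\alpha_i\ge\beta_i$ for all $i$. A composition is identified with its left-justified diagram, with rows numbered from top to bottom and $\alpha_i$ boxes in row $i$; the box in row $i$, column $j$ is $(i,j)$ and has content $c(i,j)=j-i$. **Double symmetric functions.** Let $a=(a_i)_{i\in\mathbb{Z}}$ be variables. $\Lambda_n(a)$ is the ring of symmetric polynomials in $x_1,\dots,x_n$ over $\mathbb{Z}[a]$, filtered by degree in the $x_i$ (the $a_i$ have degree $0$). $\Lambda(a)$ is the inverse limit, in filtered rings, of the $\Lambda_n(a)$ under the maps $\varphi_n:P(x_1,\dots,x_n)\mapsto P(x_1,\dots,x_{n-1},a_n)$. The double complete symmetric function $h_p(x|\!|a)\in\Lambda(a)$, $p\ge1$, is given by the compatible sequence of polynomials $$h_p(x_1,\dots,x_n|\!|a)=\sum_{n\ge i_1\ge\dots\ge i_p\ge1}(x_{i_1}-a_{i_1})(x_{i_2}-a_{i_2-1})\cdots(x_{i_p}-a_{i_p-p+1}),$$ with $h_0(x|\!|a)=1$ and $h_r(x|\!|a)=0$ for $r<0$; $\Lambda(a)$ is the polynomial ring over $\mathbb{Z}[a]$ in the $h_p(x|\!|a)$, $p\ge1$. Let $\tau$ be the ring automorphism of $\Lambda(a)$ with $\tau(a_i)=a_{i+1}$ and $\tau h_p(x|\!|a)=h_p(x|\!|a)+a_{2-p}h_{p-1}(x|\!|a)$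 for $p\ge1$. Put $h_{r,s}=\tau^s h_r(x|\!|a)$. For a partition $\mu$ with $l=l(\mu)$, the double Schur function is $s_\mu(x|\!|a)=\det\big(h_{\mu_i+j-i,\ j-1}\big)_{1\le i,j\le l}$. The double Schur functions form a basis of $\Lambda(a)$ over $\mathbb{Z}[a]$. **Tableaux.** A reverse $\lambda$-tableau $T$ is a filling of each box of the diagram $\lambda$ with a positive integer, either unbarred ($k$) or barred ($\overline{k}$), such that entries weakly decrease from left to right in each row (bars are ignored in comparisons; no column condition). $T(\alpha)$ denotes the entry in box $\alpha$, used as an integer in subscripts. The row order on the boxes reads rows from bottom to top, each row from left to right. The row word $S^r$ of $T$ is the sequence of barred entries of $T$ (with bars omitted) listed in row order; $S^r(\alpha)$ is its subsequence consisting of barred entries in boxes up to and including $\alpha$. A sequence $S=s_1\cdots s_t$ of positive integers is applied to a composition $\mu$ by forming $\mu=\rho^{(0)},\rho^{(1)},\dots,\rho^{(t)}$, where $\rho^{(i)}$ is obtained from $\rho^{(i-1)}$ by adding a box at the end of row $s_i$. One says that $S$ takes $\mu$ to $\nu=\rho^{(t)}$ (or $\nu$ is created from $\mu$ using $S$). $S$ is Yamanouchi when applied to $\mu$ if every $\rho^{(i)}$, $0\le i\le t$, is a partition. *)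

theory Defs
  imports
    "HOL-Library.Poly_Mapping"
    "HOL-Library.Function_Algebras"
    "HOL-Library.FuncSet"
    "HOL-Combinatorics.Permutations"
    "Jordan_Normal_Form.Determinant"
begin

section \<open>Polynomials in the a's and the x's\<close>

text \<open>Polynomials are finitely supported functions from exponent vectors to coefficients:
  \<open>apoly\<close> is Z[a], with the variables a indexed by the integers, and \<open>xpoly\<close> is Z[a][x].
  The product of \<^typ>\<open>'a \<Rightarrow>\<^sub>0 'b\<close> is convolution.\<close>

type_synonym apoly = "(int \<Rightarrow>\<^sub>0 nat) \<Rightarrow>\<^sub>0 int"
type_synonym xpoly = "(nat \<Rightarrow>\<^sub>0 nat) \<Rightarrow>\<^sub>0 apoly"

definition avar :: "int \<Rightarrow> apoly" where
  "avar i = Poly_Mapping.single (Poly_Mapping.single i 1) 1"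

definition xconst :: "apoly \<Rightarrow> xpoly" where
  "xconst q = Poly_Mapping.single 0 q"

definition xvar :: "nat \<Rightarrow> xpoly" where
  "xvar i = Poly_Mapping.single (Poly_Mapping.single i 1) 1"

definition subst_x :: "(nat \<Rightarrow> xpoly) \<Rightarrow> xpoly \<Rightarrow> xpoly" where
  "subst_x g P = (\<Sum>m\<in>Poly_Mapping.keys P. xconst (Poly_Mapping.lookup P m) *
     (\<Prod>i\<in>Poly_Mapping.keys m. g i ^ Poly_Mapping.lookup m i))"

definition x_degree_le :: "xpoly \<Rightarrow> nat \<Rightarrow> bool" where
  "x_degree_le P d \<longleftrightarrow> (\<forall>m\<in>Poly_Mapping.keys P.
     (\<Sum>i\<in>Poly_Mapping.keys m. Poly_Mapping.lookup m i) \<le> d)"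

section \<open>The ring of double symmetric functions\<close>

definition Lambda_fin :: "nat \<Rightarrow> xpoly set" where
  "Lambda_fin n = {P. (\<forall>m\<in>Poly_Mapping.keys P. Poly_Mapping.keys m \<subseteq> {1..n}) \<and>
     (\<forall>\<sigma>. \<sigma> permutes {1..n} \<longrightarrow> subst_x (\<lambda>i. xvar (\<sigma> i)) P = P)}"

definition phi :: "nat \<Rightarrow> xpoly \<Rightarrow> xpoly" where
  "phi n = subst_x (\<lambda>i. if i = n then xconst (avar (int n)) else xvar i)"

text \<open>The inverse limit of filtered rings: compatible sequences whose degrees in the x's are
  uniformly bounded. Ring operations on sequences are the pointwise ones.\<close>

definition Lambda :: "(nat \<Rightarrow> xpoly) set" where
  "Lambda = {F. (\<forall>n. F n \<in> Lambda_fin n) \<and> (\<forall>n\<ge>1. phi n (F n) = F (n - 1)) \<and>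
     (\<exists>d. \<forall>n. x_degree_le (F n) d)}"

definition scalar :: "apoly \<Rightarrow> nat \<Rightarrow> xpoly" where
  "scalar q = (\<lambda>n. xconst q)"

text \<open>Below \<open>is\<close> lists \<open>i\<^sub>1 \<ge> \<dots> \<ge> i\<^sub>p\<close>; its entries are numbered from 0, so the
  factor at position \<open>k\<close> is the one with subscript \<open>k + 1\<close>.\<close>

definition h_nat :: "nat \<Rightarrow> nat \<Rightarrow> xpoly" where
  "h_nat p n = (\<Sum>is\<in>{is. length is = p \<and> set is \<subseteq> {1..n} \<and> sorted_wrt (\<ge>) is}.
     \<Prod>k<p. xvar (is ! k) - xconst (avar (int (is ! k) - int k)))"

definition h :: "int \<Rightarrow> nat \<Rightarrow> xpoly" where
  "h r = (if r < 0 then 0 else h_nat (nat r))"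

text \<open>\<open>\<tau>\<close> is constrained on \<^term>\<open>Lambda\<close> only; its values on other sequences are irrelevant.\<close>

definition is_tau :: "((nat \<Rightarrow> xpoly) \<Rightarrow> (nat \<Rightarrow> xpoly)) \<Rightarrow> bool" where
  "is_tau \<tau> \<longleftrightarrow> bij_betw \<tau> Lambda Lambda \<and> \<tau> 1 = 1 \<and>
     (\<forall>F\<in>Lambda. \<forall>G\<in>Lambda. \<tau> (F + G) = \<tau> F + \<tau> G) \<and>
     (\<forall>F\<in>Lambda. \<forall>G\<in>Lambda. \<tau> (F * G) = \<tau> F * \<tau> G) \<and>
     (\<forall>i. \<tau> (scalar (avar i)) = scalar (avar (i + 1))) \<and>
     (\<forall>p\<ge>1. \<tau> (h p) = h p + scalar (avar (2 - p)) * h (p - 1))"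

definition h_shift :: "((nat \<Rightarrow> xpoly) \<Rightarrow> (nat \<Rightarrow> xpoly)) \<Rightarrow> int \<Rightarrow> nat \<Rightarrow> nat \<Rightarrow> xpoly" where
  "h_shift \<tau> r s = (\<tau> ^^ s) (h r)"

section \<open>Compositions, diagrams, double Schur functions\<close>

text \<open>Parts are numbered from 1. The unused value at 0 is set to 0 to make the encoding unique.\<close>

definition is_composition :: "(nat \<Rightarrow> nat) \<Rightarrow> bool" where
  "is_composition \<alpha> \<longleftrightarrow> \<alpha> 0 = 0 \<and> finite {i. \<alpha> i \<noteq> 0}"

definition is_partition :: "(nat \<Rightarrow> nat) \<Rightarrow> bool" where
  "is_partition \<alpha> \<longleftrightarrow> is_composition \<alpha> \<and> (\<forall>i\<ge>1. \<alpha> (i + 1) \<le> \<alpha> i)"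

definition len :: "(nat \<Rightarrow> nat) \<Rightarrow> nat" where
  "len \<alpha> = Max (insert 0 {i. \<alpha> i \<noteq> 0})"

definition diagram :: "(nat \<Rightarrow> nat) \<Rightarrow> (nat \<times> nat) set" where
  "diagram \<alpha> = {(i, j). 1 \<le> i \<and> 1 \<le> j \<and> j \<le> \<alpha> i}"

definition box_content :: "nat \<times> nat \<Rightarrow> int" where
  "box_content b = int (snd b) - int (fst b)"

text \<open>Matrix indices start at 0, so the entry in position \<open>(i, j)\<close> is the one with subscripts
  \<open>(i + 1, j + 1)\<close>.\<close>

definition double_schur ::
  "((nat \<Rightarrow> xpoly) \<Rightarrow> (nat \<Rightarrow> xpoly)) \<Rightarrow> (nat \<Rightarrow> nat) \<Rightarrow> nat \<Rightarrow> xpoly" where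
  "double_schur \<tau> \<mu> = Determinant.det (mat (len \<mu>) (len \<mu>)
     (\<lambda>(i, j). h_shift \<tau> (int (\<mu> (i + 1)) + int j - int i) j))"

section \<open>Reverse tableaux with barred entries\<close>

datatype entry = Unbarred (val: nat) | Barred (val: nat)

text \<open>Fillings are \<^const>\<open>undefined\<close> outside the diagram, so that distinct functions are distinct
  tableaux.\<close>

definition reverse_tableaux :: "(nat \<Rightarrow> nat) \<Rightarrow> (nat \<times> nat \<Rightarrow> entry) set" where
  "reverse_tableaux lam = {T. T \<in> diagram lam \<rightarrow>\<^sub>E {x. val x \<ge> 1} \<and>
     (\<forall>i j. (i, j) \<in> diagram lam \<and> (i, j + 1) \<in> diagram lam \<longrightarrow> val (T (i, j + 1)) \<le> val (T (i, j)))}"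

definition unbarred_boxes :: "(nat \<Rightarrow> nat) \<Rightarrow> (nat \<times> nat \<Rightarrow> entry) \<Rightarrow> (nat \<times> nat) set" where
  "unbarred_boxes lam T = {b \<in> diagram lam. is_Unbarred (T b)}"

definition row_order :: "(nat \<Rightarrow> nat) \<Rightarrow> (nat \<times> nat) list" where
  "row_order lam = concat (map (\<lambda>i. map (\<lambda>j. (i, j)) [1..<lam i + 1]) (rev [1..<len lam + 1]))"

definition barred_word :: "(nat \<times> nat \<Rightarrow> entry) \<Rightarrow> (nat \<times> nat) list \<Rightarrow> nat list" where
  "barred_word T bs = map (\<lambda>b. val (T b)) (filter (\<lambda>b. \<not> is_Unbarred (T b)) bs)"

definition row_word :: "(nat \<Rightarrow> nat) \<Rightarrow> (nat \<times> nat \<Rightarrow> entry) \<Rightarrow> nat list" where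
  "row_word lam T = barred_word T (row_order lam)"

definition row_word_upto ::
  "(nat \<Rightarrow> nat) \<Rightarrow> (nat \<times> nat \<Rightarrow> entry) \<Rightarrow> nat \<times> nat \<Rightarrow> nat list" where
  "row_word_upto lam T b = barred_word T (takeWhile (\<lambda>b'. b' \<noteq> b) (row_order lam) @ [b])"

definition apply_word :: "(nat \<Rightarrow> nat) \<Rightarrow> nat list \<Rightarrow> nat \<Rightarrow> nat" where
  "apply_word \<mu> S = foldl (\<lambda>\<rho> s. \<rho>(s := \<rho> s + 1)) \<mu> S"

definition yamanouchi :: "(nat \<Rightarrow> nat) \<Rightarrow> nat list \<Rightarrow> bool" where
  "yamanouchi \<mu> S \<longleftrightarrow> (\<forall>i\<le>length S. is_partition (apply_word \<mu> (take i S)))"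

section \<open>Coefficientwise sums of products of differences\<close>

text \<open>Expanding \<open>\<Prod>b\<in>B. (a\<^bsub>u b\<^esub> - a\<^bsub>v b\<^esub>)\<close>, the term which chooses the second summand exactly
  in the factors \<open>b \<in> D\<close> is the monomial with exponent vector \<open>choice_monom u v B D\<close> and sign
  \<open>(-1) ^ card D\<close>.\<close>

definition choice_monom ::
  "('b \<Rightarrow> int) \<Rightarrow> ('b \<Rightarrow> int) \<Rightarrow> 'b set \<Rightarrow> 'b set \<Rightarrow> (int \<Rightarrow>\<^sub>0 nat)" where
  "choice_monom u v B D = (\<Sum>b\<in>B. Poly_Mapping.single (if b \<in> D then v b else u b) 1)"

text \<open>\<open>has_formal_sum S B u v c\<close> means
  \<open>c = (\<Sum>t\<in>S. \<Prod>b\<in>B t. (a\<^bsub>u t b\<^esub> - a\<^bsub>v t b\<^esub>))\<close> for a possibly infinite \<open>S\<close>: every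
  monomial receives only finitely many contributions, and these add up to its coefficient in \<open>c\<close>.\<close>

definition has_formal_sum ::
  "'t set \<Rightarrow> ('t \<Rightarrow> 'b set) \<Rightarrow> ('t \<Rightarrow> 'b \<Rightarrow> int) \<Rightarrow> ('t \<Rightarrow> 'b \<Rightarrow> int) \<Rightarrow> apoly \<Rightarrow> bool" where
  "has_formal_sum S B u v c \<longleftrightarrow> (\<forall>m.
     let X = {(t, D). t \<in> S \<and> D \<subseteq> B t \<and> choice_monom (u t) (v t) (B t) D = m}
     in finite X \<and> Poly_Mapping.lookup c m = (\<Sum>(t, D)\<in>X. (-1) ^ card D))"

lemma prod_diff_expand:
  assumes "finite B"
  shows "(\<Prod>b\<in>B. avar (u b) - avar (v b)) =
    (\<Sum>D\<in>Pow B. Poly_Mapping.single (choice_monom u v B D) ((-1) ^ card D))"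
  using assms
proof (induction B rule: finite_induct)
  case empty
  show ?case by (simp add: choice_monom_def)
next
  case (insert x B)
  have inj: "inj_on (insert x) (Pow B)"
    using insert.hyps by (auto simp: inj_on_def)
  have disj: "Pow B \<inter> insert x ` Pow B = {}"
    using insert.hyps by auto
  have a: "choice_monom u v (insert x B) D = Poly_Mapping.single (u x) 1 + choice_monom u v B D"
    if "D \<subseteq> B" for D
  proof -
    have "x \<notin> D" using that insert.hyps by auto
    then show ?thesis using insert.hyps by (simp add: choice_monom_def)
  qed
  have b: "choice_monom u v (insert x B) (insert x D) =
      Poly_Mapping.single (v x) 1 + choice_monom u v B D" if "D \<subseteq> B" for D
  proof -
    have "(\<Sum>b\<in>B. Poly_Mapping.single (if b \<in> insert x D then v b else u b) (1::nat)) =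
      (\<Sum>b\<in>B. Poly_Mapping.single (if b \<in> D then v b else u b) 1)"
      by (rule sum.cong) (use insert.hyps in auto)
    then show ?thesis using insert.hyps by (simp add: choice_monom_def)
  qed
  have cd: "card (insert x D) = Suc (card D)" if "D \<subseteq> B" for D
    using that insert.hyps by (meson card_insert_disjoint finite_subset subsetD)
  have "(\<Sum>D\<in>Pow (insert x B). Poly_Mapping.single (choice_monom u v (insert x B) D) ((-1) ^ card D)) =
     (\<Sum>D\<in>Pow B. Poly_Mapping.single (choice_monom u v (insert x B) D) ((-1::int) ^ card D)) +
     (\<Sum>D\<in>Pow B. Poly_Mapping.single (choice_monom u v (insert x B) (insert x D)) ((-1) ^ card (insert x D)))"
    using insert.hyps disj
    by (simp add: Pow_insert sum.union_disjoint sum.reindex[OF inj])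
  also have "\<dots> = (\<Sum>D\<in>Pow B. avar (u x) * Poly_Mapping.single (choice_monom u v B D) ((-1) ^ card D)) +
     (\<Sum>D\<in>Pow B. - (avar (v x) * Poly_Mapping.single (choice_monom u v B D) ((-1) ^ card D)))"
    by (intro arg_cong2[where f = "(+)"] sum.cong)
       (auto simp: a b cd avar_def mult_single single_uminus)
  also have "\<dots> = (avar (u x) - avar (v x)) * (\<Prod>b\<in>B. avar (u b) - avar (v b))"
    by (simp add: insert.IH sum_distrib_left sum_negf sum_subtractf left_diff_distrib)
  finally show ?case using insert.hyps by simp
qed

lemma has_formal_sum_finite:
  assumes "finite S" and "\<And>t. t \<in> S \<Longrightarrow> finite (B t)"
  shows "has_formal_sum S B u v c \<longleftrightarrow>
    c = (\<Sum>t\<in>S. \<Prod>b\<in>B t. avar (u t b) - avar (v t b))"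
proof -
  define Y where "Y = (SIGMA t:S. Pow (B t))"
  have finY: "finite Y" unfolding Y_def using assms by auto
  have X: "{(t, D). t \<in> S \<and> D \<subseteq> B t \<and> choice_monom (u t) (v t) (B t) D = m} =
      {x \<in> Y. choice_monom (u (fst x)) (v (fst x)) (B (fst x)) (snd x) = m}" for m
    by (auto simp: Y_def)
  have sumX: "(\<Sum>(t, D)\<in>{x \<in> Y. choice_monom (u (fst x)) (v (fst x)) (B (fst x)) (snd x) = m}.
       (-1::int) ^ card D) =
     (\<Sum>(t, D)\<in>Y. (-1) ^ card D when choice_monom (u t) (v t) (B t) D = m)" for m
    using finY by (simp add: sum.inter_filter when_def case_prod_beta)
  have "(\<Sum>t\<in>S. \<Prod>b\<in>B t. avar (u t b) - avar (v t b)) =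
     (\<Sum>t\<in>S. \<Sum>D\<in>Pow (B t). Poly_Mapping.single (choice_monom (u t) (v t) (B t) D) ((-1) ^ card D))"
    by (rule sum.cong) (auto simp: prod_diff_expand assms)
  also have "\<dots> = (\<Sum>(t, D)\<in>Y. Poly_Mapping.single (choice_monom (u t) (v t) (B t) D) ((-1) ^ card D))"
    unfolding Y_def using assms by (subst sum.Sigma) auto
  finally have prod: "Poly_Mapping.lookup (\<Sum>t\<in>S. \<Prod>b\<in>B t. avar (u t b) - avar (v t b)) m =
     (\<Sum>(t, D)\<in>Y. (-1) ^ card D when choice_monom (u t) (v t) (B t) D = m)" for m
    by (simp add: lookup_sum lookup_single case_prod_beta)
  have "has_formal_sum S B u v c \<longleftrightarrow> (\<forall>m. Poly_Mapping.lookup c m =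
     Poly_Mapping.lookup (\<Sum>t\<in>S. \<Prod>b\<in>B t. avar (u t b) - avar (v t b)) m)"
    unfolding has_formal_sum_def Let_def X sumX prod using finY by auto
  also have "\<dots> \<longleftrightarrow> c = (\<Sum>t\<in>S. \<Prod>b\<in>B t. avar (u t b) - avar (v t b))"
    by (auto intro: poly_mapping_eqI)
  finally show ?thesis .
qed

end

theory Submission
  imports Defs "HOL-Computational_Algebra.Formal_Power_Series"
begin

text \<open>In finitely many variables \<open>x\<^sub>1, \<dots>, x\<^sub>n\<close>, the function \<open>h\<^bsub>r,s\<^esub>\<close> is the coefficient of \<open>w\<^sup>r\<close> in
  \<open>\<Prod>\<^bsub>2-r+s \<le> k \<le> n\<^esub> (1 - a\<^sub>k w) / \<Prod>\<^bsub>i \<le> n\<^esub> (1 - x\<^sub>i w)\<close>. Let multiplication by \<open>X\<close> act on the rows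
  of the Jacobi-Trudi matrix, indexed by \<open>b = \<mu>\<^sub>i - i\<close>, by \<open>X v\<^sub>b = v\<^bsub>b+1\<^esub> + a\<^bsub>-b\<^esub> v\<^sub>b\<close>. On the
  columns it acts with eigenvalues \<open>x\<^sub>1, \<dots>, x\<^sub>n\<close>, so replacing every row \<open>v\<close> by
  \<open>v / (1 - t X)\<close> divides the determinant by \<open>\<Prod>\<^sub>i (1 - x\<^sub>i t)\<close>. Expanding the new rows, and
  cutting each expansion where it reaches the previous row, leaves one term for every horizontal strip
  \<open>\<nu>/\<mu>\<close>. This identifies the coefficient of \<open>s\<^sub>\<nu>\<close> in \<open>h\<^bsub>p,e\<^esub> s\<^sub>\<mu>\<close> as the coefficient of
  \<open>t\<close> to the power \<open>p - |\<nu>/\<mu>|\<close> in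
  \<open>\<Prod>\<^bsub>2-p+e \<le> k \<le> n\<^esub> (1 - a\<^sub>k t) / \<Prod>\<^bsub>i \<le> n\<^esub> \<Prod>\<^bsub>\<mu>\<^sub>i \<le> m \<le> \<nu>\<^sub>i\<^esub> (1 - a\<^bsub>i-m\<^esub> t)\<close>,
  once the \<open>s\<^sub>\<nu>\<close> are known to be independent, which follows by evaluating at \<open>x\<^sub>i = a\<^bsub>i-\<kappa>\<^sub>i\<^esub>\<close>.

  Removing the first entry of a tableau shows that the tableaux with entries at most \<open>n\<close> contribute the
  same expression with \<open>n\<close> replaced by \<open>n + e\<close> in the range of the numerator. The two
  expressions differ only in monomials containing some \<open>a\<^sub>k\<close> with \<open>k > n\<close>, so they agree
  coefficientwise in the limit.\<close>

section \<open>Products of geometric series and factorial complete symmetric functions\<close>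

definition lin :: "'a::comm_ring_1 \<Rightarrow> 'a fps" where
  "lin y = 1 - fps_const y * fps_X"

definition geo :: "'a::comm_ring_1 \<Rightarrow> 'a fps" where
  "geo y = Abs_fps (\<lambda>k. y ^ k)"

text \<open>Integer indices let a recursion lower an index below 0 without case
  distinctions.\<close>

definition coeff_int :: "'a::comm_ring_1 fps \<Rightarrow> int \<Rightarrow> 'a" where
  "coeff_int F r = (if r < 0 then 0 else fps_nth F (nat r))"

definition lin_prod :: "(int \<Rightarrow> 'a::comm_ring_1) \<Rightarrow> int \<Rightarrow> int \<Rightarrow> 'a fps" where
  "lin_prod a lo hi = (\<Prod>k\<in>{lo..hi}. lin (a k))"

definition geo_prod :: "(nat \<Rightarrow> 'a::comm_ring_1) \<Rightarrow> nat set \<Rightarrow> 'a fps" where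
  "geo_prod x S = (\<Prod>i\<in>S. geo (x i))"

lemma lin_nth: "fps_nth (lin y * F) n = fps_nth F n - (if n = 0 then 0 else y * fps_nth F (n - 1))"
  by (simp add: lin_def left_diff_distrib mult.assoc)

lemma lin_nth_0 [simp]: "fps_nth (lin y) 0 = 1"
  by (simp add: lin_def)

lemma coeff_int_lin: "coeff_int (lin y * F) r = coeff_int F r - y * coeff_int F (r - 1)"
  by (auto simp: coeff_int_def lin_nth nat_diff_distrib)

lemma lin_geo [simp]: "lin y * geo y = 1"
proof (rule fps_ext)
  fix n show "fps_nth (lin y * geo y) n = fps_nth 1 n"
    by (cases n) (simp_all add: lin_nth geo_def fps_mult_nth_0)
qed

lemma geo_lin [simp]: "geo y * lin y = 1"
  by (subst mult.commute) simp

lemma coeff_int_0 [simp]: "coeff_int F 0 = fps_nth F 0"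
  by (simp add: coeff_int_def)

lemma coeff_int_of_nat [simp]: "coeff_int F (int n) = fps_nth F n"
  by (simp add: coeff_int_def)

lemma coeff_int_neg [simp]: "r < 0 \<Longrightarrow> coeff_int F r = 0"
  by (simp add: coeff_int_def)

lemma prod_lin_nth_0 [simp]: "fps_nth (\<Prod>i\<in>S. lin (f i)) 0 = 1"
  by (induction S rule: infinite_finite_induct) (simp_all add: fps_mult_nth_0)

lemma prod_geo_nth_0 [simp]: "fps_nth (\<Prod>i\<in>S. geo (f i)) 0 = 1"
  by (induction S rule: infinite_finite_induct) (simp_all add: geo_def)

lemma lin_prod_nth_0 [simp]: "fps_nth (lin_prod a lo hi) 0 = 1"
  by (simp add: lin_prod_def)

lemma geo_prod_nth_0 [simp]: "fps_nth (geo_prod x S) 0 = 1"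
  by (simp add: geo_prod_def)

lemma geo_prod_empty [simp]: "geo_prod x {} = 1"
  by (simp add: geo_prod_def)

lemma prod_lin_nth_eq_0:
  assumes "finite S" "card S < k"
  shows "fps_nth (\<Prod>i\<in>S. lin (f i)) k = 0"
  using assms
proof (induction S arbitrary: k rule: finite_induct)
  case (insert s S)
  then show ?case by (cases k) (simp_all add: lin_nth)
qed simp

text \<open>The degree is at most the number of factors. The condition \<open>r > 0\<close> matters
  for an empty interval, where the product is 1.\<close>

lemma coeff_int_lin_prod_eq_0:
  assumes "r > hi - lo + 1" "r > 0"
  shows "coeff_int (lin_prod a lo hi) r = 0"
  unfolding coeff_int_def lin_prod_def using assms by (auto intro!: prod_lin_nth_eq_0)

lemma lin_prod_lower: "lo \<le> hi + 1 \<Longrightarrow> lin_prod a (lo - 1) hi = lin (a (lo - 1)) * lin_prod a lo hi"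
proof -
  assume "lo \<le> hi + 1"
  then have "{lo - 1..hi} = insert (lo - 1) {lo..hi}" by auto
  then show ?thesis unfolding lin_prod_def by simp
qed

lemma lin_prod_upper: "lo \<le> hi \<Longrightarrow> lin_prod a lo hi = lin (a hi) * lin_prod a lo (hi - 1)"
proof -
  assume "lo \<le> hi"
  then have "{lo..hi} = insert hi {lo..hi - 1}" by auto
  then show ?thesis unfolding lin_prod_def by simp
qed

lemma geo_prod_remove:
  assumes "finite S" "i \<in> S"
  shows "geo_prod x (S - {i}) = lin (x i) * geo_prod x S"
proof -
  have "geo_prod x S = geo (x i) * geo_prod x (S - {i})"
    unfolding geo_prod_def using assms by (simp add: prod.remove)
  then have "lin (x i) * geo_prod x S = (lin (x i) * geo (x i)) * geo_prod x (S - {i})"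
    by (simp only: mult.assoc)
  then show ?thesis by simp
qed

text \<open>\<open>lin z - lin y\<close> is \<open>y - z\<close> times \<open>fps_X\<close>.
  Exchanging one linear factor in this way drives both later recursions, in
  \<open>factorial_hsum_eq\<close> and in \<open>sum_fillings\<close>.\<close>

lemma coeff_int_exchange:
  "coeff_int (lin z * F) (r + 1) = coeff_int (lin y * F) (r + 1) + (y - z) * coeff_int F r"
  unfolding coeff_int_lin by (simp add: algebra_simps)

section \<open>Sums over weakly decreasing sequences as power series coefficients\<close>

definition weak_lists :: "nat \<Rightarrow> nat \<Rightarrow> nat list set" where
  "weak_lists p n = {is. length is = p \<and> set is \<subseteq> {1..n} \<and> sorted_wrt (\<ge>) is}"

lemma finite_weak_lists [simp]: "finite (weak_lists p n)"
  by (rule finite_subset[OF _ finite_lists_length_eq[of "{1..n}" p]]) (auto simp: weak_lists_def)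

lemma weak_lists_0 [simp]: "weak_lists 0 n = {[]}"
  by (auto simp: weak_lists_def)

lemma weak_lists_Suc_0 [simp]: "weak_lists (Suc p) 0 = {}"
  by (auto simp: weak_lists_def)

lemma weak_lists_Suc_Suc:
  "weak_lists (Suc p) (Suc n) = weak_lists (Suc p) n \<union> (#) (Suc n) ` weak_lists p (Suc n)"
  (is "?L = ?R")
proof
  show "?L \<subseteq> ?R"
  proof
    fix "is" assume *: "is \<in> ?L"
    then obtain i js where [simp]: "is = i # js" by (cases "is") (auto simp: weak_lists_def)
    show "is \<in> ?R"
    proof (cases "i = Suc n")
      case True
      with * show ?thesis by (auto simp: weak_lists_def)
    next
      case False
      with * have "i \<in> {1..n}" "\<forall>j\<in>set js. 1 \<le> j \<and> j \<le> n"
        by (force simp: weak_lists_def)+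
      with * show ?thesis by (auto simp: weak_lists_def)
    qed
  qed
  show "?R \<subseteq> ?L" by (fastforce simp: weak_lists_def)
qed

text \<open>The offset \<open>c\<close> absorbs the change of positions when a leading entry is
  removed; \<open>c = 0\<close> gives the double complete functions.\<close>

definition factorial_hsum :: "(nat \<Rightarrow> 'a::comm_ring_1) \<Rightarrow> (int \<Rightarrow> 'a) \<Rightarrow> int \<Rightarrow> nat \<Rightarrow> nat \<Rightarrow> 'a" where
  "factorial_hsum x a c p n = (\<Sum>is\<in>weak_lists p n. \<Prod>k<p. x (is ! k) - a (int (is ! k) - int k - c))"

text \<open>The first entry is the largest: either it is \<open>Suc n\<close> and is split off, or
  all entries are at most \<open>n\<close>.\<close>

lemma factorial_hsum_rec:
  "factorial_hsum x a c (Suc p) (Suc n) = factorial_hsum x a c (Suc p) n +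
    (x (Suc n) - a (int (Suc n) - c)) * factorial_hsum x a (c + 1) p (Suc n)"
proof -
  let ?f = "\<lambda>is. \<Prod>k<Suc p. x (is ! k) - a (int (is ! k) - int k - c)"
  have disj: "weak_lists (Suc p) n \<inter> (#) (Suc n) ` weak_lists p (Suc n) = {}"
    by (auto simp: weak_lists_def)
  have "factorial_hsum x a c (Suc p) (Suc n) = factorial_hsum x a c (Suc p) n + (\<Sum>is\<in>(#) (Suc n) ` weak_lists p (Suc n). ?f is)"
    unfolding factorial_hsum_def weak_lists_Suc_Suc by (rule sum.union_disjoint) (use disj in auto)
  also have "(\<Sum>is\<in>(#) (Suc n) ` weak_lists p (Suc n). ?f is) = (\<Sum>is\<in>weak_lists p (Suc n). ?f (Suc n # is))"
    by (subst sum.reindex) auto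
  also have "\<dots> = (x (Suc n) - a (int (Suc n) - c)) * factorial_hsum x a (c + 1) p (Suc n)"
    unfolding factorial_hsum_def sum_distrib_left
    by (rule sum.cong[OF refl], subst prod.lessThan_Suc_shift) (simp add: algebra_simps)
  finally show ?thesis .
qed

text \<open>Induction on \<open>p\<close>, and inside it on \<open>n\<close>. Both summands of
  \<open>factorial_hsum_rec\<close> come from one series \<open>F\<close>, once multiplied by
  \<open>lin (x (Suc n))\<close> and once alone; \<open>coeff_int_exchange\<close> merges them into
  a product with the next numerator factor \<open>lin (a (int (Suc n) - c))\<close>.\<close>

lemma factorial_hsum_eq: "factorial_hsum x a c p n = coeff_int (lin_prod a (2 - int p - c) (int n - c) * geo_prod x {1..n}) (int p)"
proof (induction p arbitrary: c n)
  case 0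
  show ?case by (simp add: factorial_hsum_def)
next
  case (Suc p)
  note IH = Suc.IH
  show ?case
  proof (induction n)
    case 0
    \<comment> \<open>Without variables only the numerator is left; it has \<open>p\<close> factors,
      one too few for the coefficient at \<open>Suc p\<close>.\<close>
    have "coeff_int (lin_prod a (2 - int (Suc p) - c) (- c)) (int (Suc p)) = 0"
      by (rule coeff_int_lin_prod_eq_0) auto
    then show ?case by (simp add: factorial_hsum_def)
  next
    case (Suc n)
    define lo where "lo = 2 - int (Suc p) - c"
    define hi where "hi = int n - c"
    define F where "F = lin_prod a lo hi * geo_prod x {1..Suc n}"
    have 1: "lin_prod a lo (int (Suc n) - c) = lin (a (int (Suc n) - c)) * lin_prod a lo hi"
      by (subst lin_prod_upper) (auto simp: lo_def hi_def algebra_simps)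
    have 2: "geo_prod x {1..n} = lin (x (Suc n)) * geo_prod x {1..Suc n}"
    proof -
      have "{1..Suc n} - {Suc n} = {1..n}" by auto
      then show ?thesis using geo_prod_remove[of "{1..Suc n}" "Suc n" x] by simp
    qed
    have 3: "factorial_hsum x a (c + 1) p (Suc n) = coeff_int F (int p)"
      unfolding IH[of "c + 1" "Suc n"] F_def lo_def hi_def
      by (simp add: algebra_simps)
    have "coeff_int (lin_prod a lo (int (Suc n) - c) * geo_prod x {1..Suc n}) (int p + 1) =
      coeff_int (lin (a (int (Suc n) - c)) * F) (int p + 1)" by (simp only: 1 F_def mult.assoc)
    also have "\<dots> = coeff_int (lin (x (Suc n)) * F) (int p + 1) + (x (Suc n) - a (int (Suc n) - c)) * coeff_int F (int p)"
      by (rule coeff_int_exchange)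
    also have "lin (x (Suc n)) * F = lin_prod a lo hi * geo_prod x {1..n}"
      by (simp only: 2 F_def mult_ac)
    finally show ?case
      unfolding factorial_hsum_rec 3 Suc.IH by (simp add: lo_def hi_def algebra_simps)
  qed
qed

section \<open>Substitutions, the ring of double symmetric functions, and its shift\<close>

definition monom_eval :: "(nat \<Rightarrow> xpoly) \<Rightarrow> (nat \<Rightarrow>\<^sub>0 nat) \<Rightarrow> xpoly" where
  "monom_eval g m = (\<Prod>i\<in>Poly_Mapping.keys m. g i ^ Poly_Mapping.lookup m i)"

text \<open>Exponents outside the support are 0 and give factors 1, so several monomials can share
  one index set.\<close>

lemma monom_eval_superset:
  assumes "finite S" "Poly_Mapping.keys m \<subseteq> S"
  shows "monom_eval g m = (\<Prod>i\<in>S. g i ^ Poly_Mapping.lookup m i)"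
  unfolding monom_eval_def using assms
  by (intro prod.mono_neutral_left) (auto simp: in_keys_iff)

lemma monom_eval_0 [simp]: "monom_eval g 0 = 1"
  by (simp add: monom_eval_def)

lemma monom_eval_add: "monom_eval g (m + m') = monom_eval g m * monom_eval g m'"
proof -
  let ?S = "Poly_Mapping.keys m \<union> Poly_Mapping.keys m'"
  have "monom_eval g (m + m') = (\<Prod>i\<in>?S. g i ^ Poly_Mapping.lookup (m + m') i)"
    by (rule monom_eval_superset) (use keys_add[of m m'] in auto)
  moreover have "monom_eval g m = (\<Prod>i\<in>?S. g i ^ Poly_Mapping.lookup m i)"
    by (rule monom_eval_superset) auto
  moreover have "monom_eval g m' = (\<Prod>i\<in>?S. g i ^ Poly_Mapping.lookup m' i)"
    by (rule monom_eval_superset) auto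
  ultimately show ?thesis by (simp add: lookup_add power_add prod.distrib)
qed

lemma monom_eval_single [simp]: "monom_eval g (Poly_Mapping.single i 1) = g i"
  by (simp add: monom_eval_def)

lemma xconst_hom: "comm_ring_hom xconst"
  by unfold_locales (simp_all add: xconst_def single_add mult_single)

interpretation xconst: comm_ring_hom xconst
  by (rule xconst_hom)

lemma xconst_eq_0_iff [simp]: "xconst q = 0 \<longleftrightarrow> q = 0"
  by (metis xconst_def lookup_single_eq lookup_zero single_zero)

lemma subst_x_superset:
  assumes "finite S" "Poly_Mapping.keys P \<subseteq> S"
  shows "subst_x g P = (\<Sum>m\<in>S. xconst (Poly_Mapping.lookup P m) * monom_eval g m)"
  unfolding subst_x_def monom_eval_def[symmetric] using assms
  by (intro sum.mono_neutral_left) (auto simp: in_keys_iff)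

lemma subst_x_single: "subst_x g (Poly_Mapping.single m q) = xconst q * monom_eval g m"
  by (subst subst_x_superset[of "{m}"]) auto

lemma subst_x_0 [simp]: "subst_x g 0 = 0"
  by (simp add: subst_x_def)

lemma subst_x_add: "subst_x g (P + Q) = subst_x g P + subst_x g Q"
proof -
  let ?S = "Poly_Mapping.keys P \<union> Poly_Mapping.keys Q"
  have "subst_x g (P + Q) = (\<Sum>m\<in>?S. xconst (Poly_Mapping.lookup (P + Q) m) * monom_eval g m)"
    by (rule subst_x_superset) (use keys_add[of P Q] in auto)
  moreover have "subst_x g P = (\<Sum>m\<in>?S. xconst (Poly_Mapping.lookup P m) * monom_eval g m)"
    by (rule subst_x_superset) auto
  moreover have "subst_x g Q = (\<Sum>m\<in>?S. xconst (Poly_Mapping.lookup Q m) * monom_eval g m)"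
    by (rule subst_x_superset) auto
  ultimately show ?thesis
    by (simp add: lookup_add xconst.hom_add distrib_right sum.distrib)
qed

lemma subst_x_sum: "subst_x g (sum f S) = (\<Sum>i\<in>S. subst_x g (f i))"
  by (induction S rule: infinite_finite_induct) (simp_all add: subst_x_add)

lemma sum_singles: "P = (\<Sum>m\<in>Poly_Mapping.keys P. Poly_Mapping.single m (Poly_Mapping.lookup P m))"
proof (rule poly_mapping_eqI)
  fix k
  show "Poly_Mapping.lookup P k =
    Poly_Mapping.lookup (\<Sum>m\<in>Poly_Mapping.keys P. Poly_Mapping.single m (Poly_Mapping.lookup P m)) k"
    by (simp add: lookup_sum lookup_single when_def sum.delta in_keys_iff)
qed

lemma subst_x_mult: "subst_x g (P * Q) = subst_x g P * subst_x g Q"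
proof -
  let ?p = "\<lambda>m. Poly_Mapping.single m (Poly_Mapping.lookup P m)"
  let ?q = "\<lambda>m. Poly_Mapping.single m (Poly_Mapping.lookup Q m)"
  have "P * Q = (\<Sum>m\<in>Poly_Mapping.keys P. \<Sum>m'\<in>Poly_Mapping.keys Q. ?p m * ?q m')"
    by (subst sum_singles[of P], subst (1) sum_singles[of Q]) (rule sum_product)
  then have "subst_x g (P * Q) =
      (\<Sum>m\<in>Poly_Mapping.keys P. \<Sum>m'\<in>Poly_Mapping.keys Q. subst_x g (?p m) * subst_x g (?q m'))"
    by (simp add: subst_x_sum mult_single subst_x_single monom_eval_add xconst.hom_mult mult_ac)
  also have "\<dots> = subst_x g (\<Sum>m\<in>Poly_Mapping.keys P. ?p m) * subst_x g (\<Sum>m\<in>Poly_Mapping.keys Q. ?q m)"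
    by (simp add: subst_x_sum sum_product)
  finally show ?thesis by (simp only: sum_singles[symmetric])
qed

lemma subst_x_xconst [simp]: "subst_x g (xconst q) = xconst q"
  by (simp add: xconst_def subst_x_single)

lemma subst_x_xvar [simp]: "subst_x g (xvar i) = g i"
  using subst_x_single[of g "Poly_Mapping.single i 1" 1] by (simp add: xvar_def del: One_nat_def)

lemma subst_x_1 [simp]: "subst_x g 1 = 1"
  using subst_x_xconst[of g 1] by simp

lemma subst_x_hom: "comm_ring_hom (subst_x g)"
  by unfold_locales (simp_all add: subst_x_add subst_x_mult)

section \<open>Ring homomorphisms applied to power series coefficientwise\<close>

definition hom_fps :: "('a::comm_ring_1 \<Rightarrow> 'b::comm_ring_1) \<Rightarrow> 'a fps \<Rightarrow> 'b fps" where
  "hom_fps f F = Abs_fps (\<lambda>n. f (fps_nth F n))"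

lemma (in comm_ring_hom) hom_fps_hom: "comm_ring_hom (hom_fps hom)"
proof
  show "hom_fps hom 1 = 1"
    by (rule fps_ext) (simp add: hom_fps_def)
  show "hom_fps hom 0 = 0"
    by (rule fps_ext) (simp add: hom_fps_def)
  show "hom_fps hom (F + G) = hom_fps hom F + hom_fps hom G" for F G
    by (rule fps_ext) (simp add: hom_fps_def hom_add)
  show "hom_fps hom (F * G) = hom_fps hom F * hom_fps hom G" for F G
    by (rule fps_ext) (simp add: hom_fps_def fps_mult_nth hom_sum hom_mult)
qed

lemma (in comm_ring_hom) hom_fps_lin: "hom_fps hom (lin y) = lin (hom y)"
proof (rule fps_ext)
  fix n show "fps_nth (hom_fps hom (lin y)) n = fps_nth (lin (hom y)) n"
    by (cases n) (simp_all add: hom_fps_def lin_def hom_minus hom_uminus fps_X_def)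
qed

lemma (in comm_ring_hom) hom_fps_geo: "hom_fps hom (geo y) = geo (hom y)"
  by (rule fps_ext) (simp add: hom_fps_def geo_def hom_power)

lemma (in comm_ring_hom) hom_coeff_int: "hom (coeff_int F r) = coeff_int (hom_fps hom F) r"
  by (simp add: coeff_int_def hom_fps_def)

lemma (in comm_ring_hom) hom_fps_lin_prod: "hom_fps hom (lin_prod a lo hi) = lin_prod (\<lambda>k. hom (a k)) lo hi"
proof -
  interpret F: comm_ring_hom "hom_fps hom" by (rule hom_fps_hom)
  show ?thesis by (simp add: lin_prod_def F.hom_prod hom_fps_lin)
qed

lemma (in comm_ring_hom) hom_fps_geo_prod: "hom_fps hom (geo_prod x S) = geo_prod (\<lambda>i. hom (x i)) S"
proof -
  interpret F: comm_ring_hom "hom_fps hom" by (rule hom_fps_hom)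
  show ?thesis by (simp add: geo_prod_def F.hom_prod hom_fps_geo)
qed

lemma (in comm_ring_hom) hom_coeff_int_lin_prod_geo_prod:
  "hom (coeff_int (lin_prod a lo hi * geo_prod x S) r) = coeff_int (lin_prod (\<lambda>k. hom (a k)) lo hi * geo_prod (\<lambda>i. hom (x i)) S) r"
proof -
  interpret F: comm_ring_hom "hom_fps hom" by (rule hom_fps_hom)
  show ?thesis by (simp add: hom_coeff_int F.hom_mult hom_fps_lin_prod hom_fps_geo_prod)
qed

definition xa :: "int \<Rightarrow> xpoly" where
  "xa k = xconst (avar k)"

lemma h_nat_eq_factorial_hsum: "h_nat p n = factorial_hsum xvar xa 0 p n"
  by (simp add: h_nat_def factorial_hsum_def weak_lists_def xa_def)

lemma h_nat_eq: "h_nat p n = coeff_int (lin_prod xa (2 - int p) (int n) * geo_prod xvar {1..n}) (int p)"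
  by (simp add: h_nat_eq_factorial_hsum factorial_hsum_eq)

lemma h_nat_0 [simp]: "h_nat 0 = 1"
  by (rule ext) (simp add: h_nat_eq)

lemma subst_x_xa [simp]: "subst_x g (xa k) = xa k"
  by (simp add: xa_def)

lemma subst_x_coeff_int:
  "subst_x g (coeff_int (lin_prod xa lo hi * geo_prod xvar S) r) = coeff_int (lin_prod xa lo hi * geo_prod g S) r"
  by (simp add: comm_ring_hom.hom_coeff_int_lin_prod_geo_prod[OF subst_x_hom])

section \<open>Degree bounds and membership in \<open>Lambda\<close>\<close>

definition mdeg :: "(nat \<Rightarrow>\<^sub>0 nat) \<Rightarrow> nat" where
  "mdeg m = (\<Sum>i\<in>Poly_Mapping.keys m. Poly_Mapping.lookup m i)"

lemma mdeg_add: "mdeg (m + m') = mdeg m + mdeg m'"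
proof -
  let ?S = "Poly_Mapping.keys m \<union> Poly_Mapping.keys m'"
  have *: "mdeg k = (\<Sum>i\<in>?S. Poly_Mapping.lookup k i)" if "Poly_Mapping.keys k \<subseteq> ?S" for k
    unfolding mdeg_def using that by (intro sum.mono_neutral_left) (auto simp: in_keys_iff)
  show ?thesis
    by (subst (1 2 3) *) (use keys_add[of m m'] in \<open>auto simp: lookup_add sum.distrib\<close>)
qed

text \<open>Admissible variables and degree in one predicate, since the same ring operations
  propagate both; see \<open>Lambda_iff\<close>.\<close>

definition bounded_in :: "nat set \<Rightarrow> nat \<Rightarrow> xpoly \<Rightarrow> bool" where
  "bounded_in V d P \<longleftrightarrow> (\<forall>m\<in>Poly_Mapping.keys P. Poly_Mapping.keys m \<subseteq> V \<and> mdeg m \<le> d)"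

lemma bounded_in_mono: "bounded_in V d P \<Longrightarrow> d \<le> d' \<Longrightarrow> bounded_in V d' P"
  by (force simp: bounded_in_def)

lemma bounded_in_xconst [simp]: "bounded_in V d (xconst q)"
  by (simp add: bounded_in_def xconst_def mdeg_def)

lemma bounded_in_0 [simp]: "bounded_in V d 0"
  by (simp add: bounded_in_def)

lemma bounded_in_xvar: "i \<in> V \<Longrightarrow> bounded_in V 1 (xvar i)"
  by (simp add: bounded_in_def xvar_def mdeg_def)

lemma bounded_in_add: "bounded_in V d P \<Longrightarrow> bounded_in V d Q \<Longrightarrow> bounded_in V d (P + Q)"
  unfolding bounded_in_def using keys_add[of P Q] by blast

lemma bounded_in_diff: "bounded_in V d P \<Longrightarrow> bounded_in V d Q \<Longrightarrow> bounded_in V d (P - Q)"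
  unfolding bounded_in_def using Poly_Mapping.keys_diff[of P Q] by blast

lemma bounded_in_mult:
  assumes "bounded_in V d P" "bounded_in V d' Q"
  shows "bounded_in V (d + d') (P * Q)"
  unfolding bounded_in_def
proof
  fix m assume "m \<in> Poly_Mapping.keys (P * Q)"
  then obtain k l where m: "m = k + l" "k \<in> Poly_Mapping.keys P" "l \<in> Poly_Mapping.keys Q"
    using keys_mult[of P Q] by blast
  then show "Poly_Mapping.keys m \<subseteq> V \<and> mdeg m \<le> d + d'"
    using assms keys_add[of k l] unfolding bounded_in_def m(1) mdeg_add
    by (meson Un_least add_mono order_trans)
qed

lemma bounded_in_sum: "(\<And>i. i \<in> S \<Longrightarrow> bounded_in V d (f i)) \<Longrightarrow> bounded_in V d (sum f S)"
  by (induction S rule: infinite_finite_induct) (simp_all add: bounded_in_add)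

lemma bounded_in_prod:
  fixes p :: nat
  assumes "\<And>k. k < p \<Longrightarrow> bounded_in V 1 (f k)"
  shows "bounded_in V p (\<Prod>k<p. f k)"
  using assms
proof (induction p)
  case 0
  have "bounded_in V 0 (xconst 1)" by (rule bounded_in_xconst)
  then show ?case by simp
next
  case (Suc p)
  then have "bounded_in V (p + 1) ((\<Prod>k<p. f k) * f p)"
    by (intro bounded_in_mult) auto
  then show ?case by simp
qed

lemma bounded_in_h_nat: "bounded_in {1..n} p (h_nat p n)"
  unfolding h_nat_def
proof (intro bounded_in_sum bounded_in_prod bounded_in_diff bounded_in_xconst bounded_in_xvar)
  fix "is" :: "nat list" and k
  assume "is \<in> {is. length is = p \<and> set is \<subseteq> {1..n} \<and> sorted_wrt (\<ge>) is}" "k < p"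
  then show "is ! k \<in> {1..n}" using nth_mem by blast
qed

lemma Lambda_iff:
  "F \<in> Lambda \<longleftrightarrow> (\<forall>n \<sigma>. \<sigma> permutes {1..n} \<longrightarrow> subst_x (\<lambda>i. xvar (\<sigma> i)) (F n) = F n) \<and>
     (\<forall>n\<ge>1. phi n (F n) = F (n - 1)) \<and> (\<exists>d. \<forall>n. bounded_in {1..n} d (F n))"
  unfolding Lambda_def Lambda_fin_def x_degree_le_def bounded_in_def mdeg_def by blast

lemma geo_prod_permute: "\<sigma> permutes S \<Longrightarrow> geo_prod (\<lambda>i. x (\<sigma> i)) S = geo_prod x S"
  unfolding geo_prod_def by (rule prod.permute[symmetric, unfolded comp_def])

text \<open>Symmetry and stability are read off the product form \<open>h_nat_eq\<close>:
  \<open>geo_prod\<close> is symmetric, and setting \<open>x_n\<close> to \<open>a_n\<close> makes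
  its factor cancel the last numerator factor. The degree bound comes from the defining sum.\<close>

lemma h_nat_in_Lambda: "h_nat p \<in> Lambda"
  unfolding Lambda_iff
proof (intro conjI allI impI exI)
  fix n and \<sigma> :: "nat \<Rightarrow> nat"
  assume "\<sigma> permutes {1..n}"
  then show "subst_x (\<lambda>i. xvar (\<sigma> i)) (h_nat p n) = h_nat p n"
    unfolding h_nat_eq subst_x_coeff_int by (simp only: geo_prod_permute)
next
  fix n :: nat assume n: "1 \<le> n"
  show "phi n (h_nat p n) = h_nat p (n - 1)"
  \<comment> \<open>For \<open>p = 0\<close> and \<open>n = 1\<close> the numerator interval is
    empty and has no last factor to cancel.\<close>
  proof (cases "p = 0")
    case True
    then show ?thesis by (simp add: phi_def)
  next
    case False
    define y where "y = (\<lambda>i. if i = n then xconst (avar (int n)) else xvar i)"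
    have "{1..n} = insert n {1..n - 1}" using n by auto
    then have g: "geo_prod y {1..n} = geo (xa (int n)) * geo_prod y {1..n - 1}"
      using n by (simp add: geo_prod_def y_def xa_def)
    have g': "geo_prod y {1..n - 1} = geo_prod xvar {1..n - 1}"
      unfolding geo_prod_def using n by (intro prod.cong) (auto simp: y_def)
    have f: "lin_prod xa (2 - int p) (int n) = lin (xa (int n)) * lin_prod xa (2 - int p) (int (n - 1))"
      using n False by (subst lin_prod_upper) (auto simp: of_nat_diff)
    have "phi n (h_nat p n) = coeff_int (lin_prod xa (2 - int p) (int n) * geo_prod y {1..n}) (int p)"
      unfolding h_nat_eq phi_def y_def[symmetric] subst_x_coeff_int ..
    also have "lin_prod xa (2 - int p) (int n) * geo_prod y {1..n} =
        (lin (xa (int n)) * geo (xa (int n))) * (lin_prod xa (2 - int p) (int (n - 1)) * geo_prod xvar {1..n - 1})"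
      unfolding f g g' by (simp only: mult_ac)
    finally show ?thesis by (simp add: h_nat_eq)
  qed
next
  show "bounded_in {1..n} p (h_nat p n)" for n by (rule bounded_in_h_nat)
qed

lemma Lambda_scalar_mult: "F \<in> Lambda \<Longrightarrow> scalar q * F \<in> Lambda"
  unfolding Lambda_iff scalar_def
  by (auto simp: subst_x_mult phi_def) (metis bounded_in_mult bounded_in_xconst)

lemma Lambda_0 [simp]: "0 \<in> Lambda"
  by (simp add: Lambda_iff phi_def)

lemma h_in_Lambda: "h r \<in> Lambda"
  by (simp add: h_def h_nat_in_Lambda)

lemma scalar_in_Lambda: "scalar q \<in> Lambda"
  using Lambda_scalar_mult[OF h_nat_in_Lambda[of 0], of q] by simp

text \<open>The defining rule covers \<open>r \<ge> 1\<close> only. For \<open>r = 0\<close> the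
  claim is \<open>\<tau> 1 = 1\<close>, because \<open>h (-1) = 0\<close>; for \<open>r < 0\<close>
  both sides vanish, additivity giving \<open>\<tau> 0 = 0\<close>.\<close>

lemma tau_h:
  assumes "is_tau \<tau>"
  shows "\<tau> (h r) = h r + scalar (avar (2 - r)) * h (r - 1)"
proof -
  have add: "\<tau> (F + G) = \<tau> F + \<tau> G" if "F \<in> Lambda" "G \<in> Lambda" for F G
    using assms that by (simp add: is_tau_def)
  have "\<tau> 0 = 0" using add[of 0 0] by simp
  moreover have "\<tau> 1 = 1" using assms by (simp add: is_tau_def)
  ultimately show ?thesis
    using assms by (cases "r \<ge> 1"; cases "r = 0") (auto simp: is_tau_def h_def)
qed

text \<open>Since \<open>is_tau\<close> constrains \<open>\<tau>\<close> on \<open>Lambda\<close>,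
  membership has to be carried along the iteration.\<close>

lemma tau_funpow:
  assumes "is_tau \<tau>"
  shows "F \<in> Lambda \<Longrightarrow> (\<tau> ^^ s) F \<in> Lambda"
    and "F \<in> Lambda \<Longrightarrow> G \<in> Lambda \<Longrightarrow> (\<tau> ^^ s) (F + G) = (\<tau> ^^ s) F + (\<tau> ^^ s) G"
    and "F \<in> Lambda \<Longrightarrow> G \<in> Lambda \<Longrightarrow> (\<tau> ^^ s) (F * G) = (\<tau> ^^ s) F * (\<tau> ^^ s) G"
    and "(\<tau> ^^ s) (scalar (avar i)) = scalar (avar (i + int s))"
proof -
  have cl: "\<tau> F \<in> Lambda" if "F \<in> Lambda" for F
    using assms that bij_betwE[of \<tau> Lambda Lambda] by (simp add: is_tau_def)
  show L: "F \<in> Lambda \<Longrightarrow> (\<tau> ^^ s) F \<in> Lambda" for s F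
    by (induction s) (simp_all add: cl)
  show "F \<in> Lambda \<Longrightarrow> G \<in> Lambda \<Longrightarrow> (\<tau> ^^ s) (F + G) = (\<tau> ^^ s) F + (\<tau> ^^ s) G"
    using assms by (induction s) (simp_all add: L is_tau_def)
  show "F \<in> Lambda \<Longrightarrow> G \<in> Lambda \<Longrightarrow> (\<tau> ^^ s) (F * G) = (\<tau> ^^ s) F * (\<tau> ^^ s) G"
    using assms by (induction s) (simp_all add: L is_tau_def)
  show "(\<tau> ^^ s) (scalar (avar i)) = scalar (avar (i + int s))"
    using assms by (induction s) (simp_all add: is_tau_def algebra_simps)
qed

lemma h_shift_Suc:
  assumes "is_tau \<tau>"
  shows "h_shift \<tau> r (Suc s) = h_shift \<tau> r s + scalar (avar (2 - r + int s)) * h_shift \<tau> (r - 1) s"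
  unfolding h_shift_def funpow_Suc_right comp_def tau_h[OF assms]
  by (simp add: tau_funpow[OF assms] h_in_Lambda Lambda_scalar_mult scalar_in_Lambda)

text \<open>Each application of \<open>\<tau>\<close> removes the lowest numerator factor: the term
  added in \<open>h_shift_Suc\<close> is exactly what that factor subtracts from the coefficient of
  the remaining series \<open>F\<close>. The bound on \<open>s\<close> ensures that there is a
  factor to remove.\<close>

lemma h_shift_eq:
  assumes "is_tau \<tau>" "2 - r + int s \<le> int n + 1"
  shows "h_shift \<tau> r s n = coeff_int (lin_prod xa (2 - r + int s) (int n) * geo_prod xvar {1..n}) r"
  using assms(2)
proof (induction s arbitrary: r)
  case 0
  show ?case
    by (cases "r < 0") (simp_all add: h_shift_def h_def h_nat_eq)
next
  case (Suc s)
  define F where "F = lin_prod xa (3 - r + int s) (int n) * geo_prod xvar {1..n}"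
  have f: "lin_prod xa (2 - r + int s) (int n) = lin (xa (2 - r + int s)) * lin_prod xa (3 - r + int s) (int n)"
    using lin_prod_lower[of "3 - r + int s" "int n" xa] Suc.prems by (simp add: algebra_simps)
  have "h_shift \<tau> r s n = coeff_int (lin (xa (2 - r + int s)) * F) r"
    using Suc by (simp add: f F_def mult.assoc)
  moreover have "h_shift \<tau> (r - 1) s n = coeff_int F (r - 1)"
    using Suc.IH[of "r - 1"] Suc.prems by (simp add: F_def algebra_simps)
  moreover have *: "2 - r + int (Suc s) = 3 - r + int s" by simp
  ultimately show ?case
    unfolding * F_def[symmetric] by (simp add: h_shift_Suc[OF assms(1)] scalar_def xa_def[symmetric] coeff_int_lin)
qed

section \<open>Double Schur functions in finitely many variables\<close>

text \<open>The entry in column \<open>j\<close> of the Jacobi-Trudi matrix after unitriangular column operations, which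
  cancel the variables \<open>x\<^sub>1, \<dots>, x\<^bsub>j-1\<^esub>\<close>. In this form \<open>X\<close> acts on the columns by a bidiagonal matrix.\<close>

definition flag_entry :: "(int \<Rightarrow> 'a::comm_ring_1) \<Rightarrow> (nat \<Rightarrow> 'a) \<Rightarrow> nat \<Rightarrow> int \<Rightarrow> nat \<Rightarrow> 'a" where
  "flag_entry a x n b j = coeff_int (lin_prod a (1 - b) (int n) * geo_prod x {j..n}) (b + int j)"

text \<open>Both sides equal the coefficient of \<open>F\<close> at \<open>b + 1 + int j\<close>,
  the second term on either side undoing the linear factor of the first. The left side is the action
  of \<open>X\<close> on rows, the right side its action on columns.\<close>

lemma flag_entry_rec:
  assumes "- int n \<le> b" "j \<in> {1..n}"
  shows "flag_entry a x n (b + 1) j + a (- b) * flag_entry a x n b j = flag_entry a x n b (Suc j) + x j * flag_entry a x n b j"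
proof -
  define F where "F = lin_prod a (1 - b) (int n) * geo_prod x {j..n}"
  have "lin_prod a (1 - (b + 1)) (int n) = lin (a (- b)) * lin_prod a (1 - b) (int n)"
    using lin_prod_lower[of "1 - b" "int n" a] assms by simp
  then have "flag_entry a x n (b + 1) j = coeff_int (lin (a (- b)) * F) (b + 1 + int j)"
    by (simp only: flag_entry_def F_def mult.assoc)
  moreover have "geo_prod x {Suc j..n} = lin (x j) * geo_prod x {j..n}"
  proof -
    have "{j..n} - {j} = {Suc j..n}" by auto
    then show ?thesis using geo_prod_remove[of "{j..n}" j x] assms by simp
  qed
  then have "flag_entry a x n b (Suc j) = coeff_int (lin (x j) * F) (b + int (Suc j))"
    by (simp only: flag_entry_def F_def mult_ac)
  moreover have "flag_entry a x n b j = coeff_int F (b + int j)"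
    by (simp add: flag_entry_def F_def)
  moreover have "b + int (Suc j) = b + 1 + int j" by simp
  ultimately show ?thesis
    by (simp only: coeff_int_lin) (simp add: algebra_simps)
qed

text \<open>No \<open>x\<close> is left, and a polynomial of degree at most \<open>n + b\<close> has
  no coefficient at \<open>b + n + 1\<close>. Hence the column recursion closes after
  \<open>n\<close> columns and \<open>X\<close> acts on them triangularly.\<close>

lemma flag_entry_last: "- int n \<le> b \<Longrightarrow> flag_entry a x n b (Suc n) = 0"
  by (simp add: flag_entry_def coeff_int_lin_prod_eq_0)

definition schur_det :: "(int \<Rightarrow> 'a::comm_ring_1) \<Rightarrow> (nat \<Rightarrow> 'a) \<Rightarrow> nat \<Rightarrow> (nat \<Rightarrow> int) \<Rightarrow> 'a" where
  "schur_det a x n b = Determinant.det (mat n n (\<lambda>(i, j). flag_entry a x n (b i) (Suc j)))"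

lemma prod_list_diag_eq_1: "(\<And>i. i < n \<Longrightarrow> f (i, i) = 1) \<Longrightarrow> prod_list (diag_mat (mat n n f)) = (1::'a::comm_ring_1)"
  by (simp add: prod_list_diag_prod)

text \<open>The rows from \<open>l\<close> on are unitriangular and are stripped by expansion along
  the last row. This brings the determinants of all partitions to one size \<open>n\<close>.\<close>

lemma det_pad:
  fixes E :: "nat \<Rightarrow> nat \<Rightarrow> 'a::comm_ring_1"
  assumes "l \<le> n" and z: "\<And>i j. l \<le> i \<Longrightarrow> i < n \<Longrightarrow> j < i \<Longrightarrow> E i j = 0"
    and o: "\<And>i. l \<le> i \<Longrightarrow> i < n \<Longrightarrow> E i i = 1"
  shows "Determinant.det (mat n n (\<lambda>(i, j). E i j)) = Determinant.det (mat l l (\<lambda>(i, j). E i j))"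
  using assms
proof (induction n rule: dec_induct)
  case base
  then show ?case by simp
next
  case (step n)
  let ?M = "mat (Suc n) (Suc n) (\<lambda>(i, j). E i j)"
  have "Determinant.det ?M = (\<Sum>j<Suc n. ?M $$ (n, j) * cofactor ?M n j)"
    by (rule laplace_expansion_row) auto
  also have "\<dots> = (\<Sum>j\<in>{n}. ?M $$ (n, j) * cofactor ?M n j)"
    by (rule sum.mono_neutral_right) (use step in auto)
  also have "\<dots> = Determinant.det (mat_delete ?M n n)"
    using step by (simp add: cofactor_def)
  also have "mat_delete ?M n n = mat n n (\<lambda>(i, j). E i j)"
    by (rule eq_matI) (auto simp: mat_delete_def)
  finally show ?case using step by simp
qed

text \<open>A summation range independent of \<open>r\<close> lets the convolution be read as a
  matrix product.\<close>

lemma coeff_int_mult_bounded: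
  assumes "\<And>d. d > j \<Longrightarrow> fps_nth L d = 0"
  shows "coeff_int (L * F) r = (\<Sum>d\<le>j. fps_nth L d * coeff_int F (r - int d))"
proof (cases "r < 0")
  case True
  then show ?thesis by simp
next
  case False
  have "coeff_int (L * F) r = (\<Sum>d\<in>{0..nat r}. fps_nth L d * fps_nth F (nat r - d))"
    using False by (simp add: coeff_int_def fps_mult_nth)
  also have "\<dots> = (\<Sum>d\<in>{..nat r} \<union> {..j}. fps_nth L d * coeff_int F (r - int d))"
    by (rule sum.mono_neutral_cong_left) (use False in \<open>auto simp: coeff_int_def nat_diff_distrib\<close>)
  also have "\<dots> = (\<Sum>d\<le>j. fps_nth L d * coeff_int F (r - int d))"
    by (rule sum.mono_neutral_right) (use assms in auto)
  finally show ?thesis .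
qed

text \<open>In column \<open>j\<close>, counted from 0, multiplication by \<open>L j\<close> cancels
  the factors of \<open>x 1\<close> to \<open>x j\<close> in \<open>geo_prod\<close>. The
  coefficients of \<open>L j\<close> form column \<open>j\<close> of the unitriangular matrix
  \<open>U\<close>.\<close>

lemma schur_det_eq_det:
  "schur_det a x n b = Determinant.det (mat n n (\<lambda>(i, j).
    coeff_int (lin_prod a (1 - b i) (int n) * geo_prod x {1..n}) (b i + int (Suc j))))"
proof -
  define M where "M = mat n n (\<lambda>(i, j). coeff_int (lin_prod a (1 - b i) (int n) * geo_prod x {1..n}) (b i + int (Suc j)))"
  define L where "L = (\<lambda>j. \<Prod>i\<in>{1..j}. lin (x i))"
  define U where "U = mat n n (\<lambda>(k, j). coeff_int (L j) (int j - int k))"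
  have M: "M \<in> carrier_mat n n" and U: "U \<in> carrier_mat n n"
    by (auto simp: M_def U_def)
  have "Determinant.det U = prod_list (diag_mat U)"
    by (rule det_upper_triangular[OF _ U]) (auto simp: U_def upper_triangular_def)
  also have "\<dots> = 1"
    unfolding U_def by (rule prod_list_diag_eq_1) (simp add: L_def)
  finally have detU: "Determinant.det U = 1" .
  have "mat n n (\<lambda>(i, j). flag_entry a x n (b i) (Suc j)) = M * U"
  proof (rule eq_matI)
    fix i j assume "i < dim_row (M * U)" "j < dim_col (M * U)"
    then have i: "i < n" and j: "j < n" by (auto simp: M_def U_def)
    define F where "F = lin_prod a (1 - b i) (int n) * geo_prod x {1..n}"
    have Lnth: "fps_nth (L j) d = 0" if "d > j" for d
      unfolding L_def by (rule prod_lin_nth_eq_0) (use that in auto)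
    have "{1..n} = {1..j} \<union> {Suc j..n}" using j by auto
    then have "geo_prod x {1..n} = geo_prod x {1..j} * geo_prod x {Suc j..n}"
      unfolding geo_prod_def by (simp add: prod.union_disjoint)
    moreover have "L j * geo_prod x {1..j} = 1"
      unfolding L_def geo_prod_def prod.distrib[symmetric] by simp
    ultimately have "L j * geo_prod x {1..n} = geo_prod x {Suc j..n}"
      by (simp add: mult.assoc[symmetric])
    then have "flag_entry a x n (b i) (Suc j) = coeff_int (L j * F) (b i + int (Suc j))"
      by (simp only: flag_entry_def F_def mult.left_commute[of "L j"])
    also have "\<dots> = (\<Sum>d\<le>j. fps_nth (L j) d * coeff_int F (b i + int (Suc j) - int d))"
      by (rule coeff_int_mult_bounded) (rule Lnth)
    also have "\<dots> = (\<Sum>k\<le>j. coeff_int F (b i + int (Suc k)) * coeff_int (L j) (int j - int k))"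
      by (rule sum.reindex_bij_witness[of _ "\<lambda>k. j - k" "\<lambda>k. j - k"])
        (auto simp: coeff_int_def algebra_simps of_nat_diff nat_diff_distrib)
    also have "\<dots> = (\<Sum>k\<in>{0..<n}. coeff_int F (b i + int (Suc k)) * coeff_int (L j) (int j - int k))"
      by (rule sum.mono_neutral_left) (use j in auto)
    also have "\<dots> = (M * U) $$ (i, j)"
      using i j by (simp add: M_def U_def scalar_prod_def F_def)
    finally show "mat n n (\<lambda>(i, j). flag_entry a x n (b i) (Suc j)) $$ (i, j) = (M * U) $$ (i, j)"
      using i j by simp
  qed (auto simp: M_def U_def)
  then show ?thesis
    unfolding schur_det_def M_def[symmetric] by (simp add: det_mult[OF M U] detU)
qed

text \<open>The index \<open>b\<close> of a row of the matrix; rows count from 0, parts from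
  1.\<close>

definition shifted_part :: "(nat \<Rightarrow> nat) \<Rightarrow> nat \<Rightarrow> int" where
  "shifted_part \<mu> i = int (\<mu> (Suc i)) - int (Suc i)"

lemma apply_hom: "comm_ring_hom (\<lambda>F :: nat \<Rightarrow> xpoly. F n)"
  by unfold_locales simp_all

text \<open>Evaluation at \<open>n\<close> is a ring homomorphism, so it passes into the
  determinant, where \<open>h_shift_eq\<close> applies to the entries.\<close>

lemma double_schur_eq:
  assumes tau: "is_tau \<tau>" and l: "len \<mu> \<le> n" and z: "\<And>i. i > len \<mu> \<Longrightarrow> \<mu> i = 0"
  shows "double_schur \<tau> \<mu> n = schur_det xa xvar n (shifted_part \<mu>)"
proof -
  define E where "E = (\<lambda>i j. coeff_int (lin_prod xa (1 - shifted_part \<mu> i) (int n) * geo_prod xvar {1..n}) (shifted_part \<mu> i + int (Suc j)))"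
  let ?l = "len \<mu>"
  have "double_schur \<tau> \<mu> n = Determinant.det (map_mat (\<lambda>F. F n) (mat ?l ?l
     (\<lambda>(i, j). h_shift \<tau> (int (\<mu> (i + 1)) + int j - int i) j)))"
    unfolding double_schur_def by (rule comm_ring_hom.hom_det[OF apply_hom, symmetric])
  also have "map_mat (\<lambda>F. F n) (mat ?l ?l (\<lambda>(i, j). h_shift \<tau> (int (\<mu> (i + 1)) + int j - int i) j)) =
      mat ?l ?l (\<lambda>(i, j). E i j)"
  proof (rule eq_matI)
    fix i j assume "i < dim_row (mat ?l ?l (\<lambda>(i, j). E i j))" "j < dim_col (mat ?l ?l (\<lambda>(i, j). E i j))"
    then have ij: "i < ?l" "j < ?l" by auto
    let ?r = "int (\<mu> (i + 1)) + int j - int i"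
    have r: "1 - shifted_part \<mu> i = 2 - ?r + int j" "shifted_part \<mu> i + int (Suc j) = ?r"
      by (auto simp: shifted_part_def)
    have "h_shift \<tau> ?r j n = coeff_int (lin_prod xa (2 - ?r + int j) (int n) * geo_prod xvar {1..n}) ?r"
      by (rule h_shift_eq[OF tau]) (use ij l in auto)
    then have "h_shift \<tau> ?r j n = E i j"
      by (simp only: E_def r)
    then show "map_mat (\<lambda>F. F n) (mat ?l ?l (\<lambda>(i, j). h_shift \<tau> (int (\<mu> (i + 1)) + int j - int i) j)) $$ (i, j) =
        mat ?l ?l (\<lambda>(i, j). E i j) $$ (i, j)"
      using ij by simp
  qed auto
  \<comment> \<open>In rows past the length the entry is a coefficient at
    \<open>int j - int i\<close>: 0 left of the diagonal, and the constant term 1 on it.\<close>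
  also have "Determinant.det (mat ?l ?l (\<lambda>(i, j). E i j)) = Determinant.det (mat n n (\<lambda>(i, j). E i j))"
    by (rule det_pad[symmetric]) (use l z in \<open>auto simp: E_def shifted_part_def\<close>)
  also have "\<dots> = schur_det xa xvar n (shifted_part \<mu>)"
    unfolding schur_det_eq_det E_def ..
  finally show ?thesis .
qed

section \<open>The Pieri rule for determinants\<close>

text \<open>Expanding \<open>v_b / (1 - t X)\<close> divides by one more
  \<open>lin (a (- (b + m)))\<close> at each step; the run of length \<open>Suc k\<close> belongs to
  \<open>v_(b+k)\<close>.\<close>

definition geo_run :: "(int \<Rightarrow> 'a::comm_ring_1) \<Rightarrow> int \<Rightarrow> nat \<Rightarrow> 'a fps" where
  "geo_run a b k = (\<Prod>m<k. geo (a (- (b + int m))))"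

text \<open>\<open>w K\<close> is the expansion of \<open>v_b / (1 - t X)\<close> cut after
  \<open>K\<close> terms; applying \<open>1 - t X\<close> leaves \<open>v_b\<close> and a single
  remainder at \<open>b + K\<close>. In column \<open>j\<close>, \<open>1 - t X\<close> gives
  \<open>lin (x j)\<close> times that column minus \<open>fps_X\<close> times the next one.\<close>

lemma telescope:
  fixes a :: "int \<Rightarrow> 'a::comm_ring_1" and x :: "nat \<Rightarrow> 'a"
  assumes "- int n \<le> b" "j \<in> {1..n}"
  defines "w \<equiv> \<lambda>K j. \<Sum>k<K. fps_X ^ k * geo_run a b (Suc k) * fps_const (flag_entry a x n (b + int k) j)"
  shows "lin (x j) * w K j - fps_X * w K (Suc j) =
    fps_const (flag_entry a x n b j) - fps_X ^ K * geo_run a b K * fps_const (flag_entry a x n (b + int K) j)"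
proof (induction K)
  case 0
  show ?case by (simp add: w_def geo_run_def)
next
  case (Suc K)
  let ?m = "\<lambda>k j. fps_const (flag_entry a x n (b + int k) j)"
  define z where "z = a (- (b + int K))"
  have rec: "flag_entry a x n (b + int (Suc K)) j + z * flag_entry a x n (b + int K) j =
      flag_entry a x n (b + int K) (Suc j) + x j * flag_entry a x n (b + int K) j"
    using flag_entry_rec[of n "b + int K" j a x] assms(1,2) by (simp add: z_def algebra_simps)
  have "lin (x j) * ?m K j - fps_X * ?m K (Suc j) =
      ?m K j - fps_X * fps_const (flag_entry a x n (b + int K) (Suc j) + x j * flag_entry a x n (b + int K) j)"
    by (simp add: lin_def algebra_simps flip: fps_const_add fps_const_mult)
  also have "\<dots> = lin z * ?m K j - fps_X * ?m (Suc K) j"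
    unfolding rec[symmetric] by (simp add: lin_def algebra_simps flip: fps_const_add fps_const_mult)
  finally have 1: "lin (x j) * ?m K j - fps_X * ?m K (Suc j) = lin z * ?m K j - fps_X * ?m (Suc K) j" .
  \<comment> \<open>Absorbing \<open>lin z\<close> shortens the run by one, so that the new term
    cancels the old remainder.\<close>
  have 2: "geo_run a b (Suc K) * lin z = geo_run a b K"
    by (simp add: geo_run_def z_def mult.assoc)
  let ?G = "fps_X ^ K * geo_run a b (Suc K)"
  have "lin (x j) * w (Suc K) j - fps_X * w (Suc K) (Suc j) =
      (lin (x j) * w K j - fps_X * w K (Suc j)) + ?G * (lin (x j) * ?m K j - fps_X * ?m K (Suc j))"
    by (simp add: w_def algebra_simps)
  also have "?G * (lin (x j) * ?m K j - fps_X * ?m K (Suc j)) =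
      fps_X ^ K * (geo_run a b (Suc K) * lin z) * ?m K j - fps_X ^ Suc K * geo_run a b (Suc K) * ?m (Suc K) j"
    unfolding 1 by (simp add: algebra_simps)
  finally show ?case unfolding 2 Suc.IH by simp
qed

section \<open>Congruence modulo a power of \<open>fps_X\<close> and multilinear expansion of
  determinants\<close>

definition eq_upto :: "nat \<Rightarrow> 'a::comm_ring_1 fps \<Rightarrow> 'a fps \<Rightarrow> bool" where
  "eq_upto K f g \<longleftrightarrow> (\<forall>r<K. fps_nth f r = fps_nth g r)"

lemma eq_upto_refl [simp]: "eq_upto K f f"
  by (simp add: eq_upto_def)

lemma eq_upto_mult: "eq_upto K f g \<Longrightarrow> eq_upto K f' g' \<Longrightarrow> eq_upto K (f * f') (g * g')"
  by (simp add: eq_upto_def fps_mult_nth)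

lemma eq_upto_prod: "(\<And>i. i \<in> S \<Longrightarrow> eq_upto K (f i) (g i)) \<Longrightarrow> eq_upto K (prod f S) (prod g S)"
  by (induction S rule: infinite_finite_induct) (auto intro: eq_upto_mult)

lemma eq_upto_sum: "(\<And>i. i \<in> S \<Longrightarrow> eq_upto K (f i) (g i)) \<Longrightarrow> eq_upto K (sum f S) (sum g S)"
  by (simp add: eq_upto_def fps_sum_nth)

lemma permutes_atLeast0_less: "q permutes {0..<n} \<Longrightarrow> i < n \<Longrightarrow> q i < (n::nat)"
  using permutes_in_image[of q "{0..<n}" i] by simp

lemma eq_upto_det:
  assumes "\<And>i j. i < n \<Longrightarrow> j < n \<Longrightarrow> eq_upto K (P i j) (Q i j)"
  shows "eq_upto K (Determinant.det (mat n n (\<lambda>(i, j). P i j))) (Determinant.det (mat n n (\<lambda>(i, j). Q i j)))"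
proof -
  have "mat n n (\<lambda>(i, j). P i j) \<in> carrier_mat n n" "mat n n (\<lambda>(i, j). Q i j) \<in> carrier_mat n n"
    by auto
  note this[THEN det_def']
  then show ?thesis
    by (simp only:) (intro eq_upto_sum eq_upto_mult eq_upto_prod eq_upto_refl,
      auto simp: permutes_atLeast0_less intro!: assms)
qed

text \<open>Multilinearity in the rows; \<open>f\<close> selects one summand in each row.\<close>

lemma det_sum_rows:
  fixes m :: "nat \<Rightarrow> nat \<Rightarrow> nat \<Rightarrow> 'a::comm_ring_1"
  assumes fin: "\<And>i. i < n \<Longrightarrow> finite (S i)"
  shows "Determinant.det (mat n n (\<lambda>(i, j). \<Sum>k\<in>S i. c i k * m i k j)) =
    (\<Sum>f\<in>Pi\<^sub>E {0..<n} S. (\<Prod>i=0..<n. c i (f i)) * Determinant.det (mat n n (\<lambda>(i, j). m i (f i) j)))"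
proof -
  have d: "Determinant.det (mat n n (\<lambda>(i, j). E i j)) =
      (\<Sum>q | q permutes {0..<n}. signof q * (\<Prod>i=0..<n. E i (q i)))" for E :: "nat \<Rightarrow> nat \<Rightarrow> 'a"
  proof -
    have "mat n n (\<lambda>(i, j). E i j) \<in> carrier_mat n n" by auto
    from det_def'[OF this] show ?thesis
      by (simp only:) (intro sum.cong refl arg_cong2[of _ _ _ _ "(*)"] prod.cong, auto simp: permutes_atLeast0_less)
  qed
  have "Determinant.det (mat n n (\<lambda>(i, j). \<Sum>k\<in>S i. c i k * m i k j)) =
      (\<Sum>q | q permutes {0..<n}. signof q * (\<Sum>f\<in>Pi\<^sub>E {0..<n} S. \<Prod>i=0..<n. c i (f i) * m i (f i) (q i)))"
    unfolding d using fin by (subst prod_sum_PiE) auto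
  also have "\<dots> = (\<Sum>f\<in>Pi\<^sub>E {0..<n} S. \<Sum>q | q permutes {0..<n}.
      signof q * (\<Prod>i=0..<n. c i (f i) * m i (f i) (q i)))"
    unfolding sum_distrib_left by (rule sum.swap)
  also have "\<dots> = (\<Sum>f\<in>Pi\<^sub>E {0..<n} S. (\<Prod>i=0..<n. c i (f i)) *
      (\<Sum>q | q permutes {0..<n}. signof q * (\<Prod>i=0..<n. m i (f i) (q i))))"
    by (simp add: sum_distrib_left prod.distrib mult_ac)
  finally show ?thesis unfolding d .
qed

text \<open>Serves to multiply by a unit lower bidiagonal matrix, where row \<open>i\<close>
  receives a multiple of row \<open>i - 1\<close>.\<close>

lemma sum_two_deltas:
  fixes f :: "nat \<Rightarrow> 'a::comm_ring_1"
  assumes "i < n"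
  shows "(\<Sum>k\<in>{0..<n}. (if k = i then 1 else if i = Suc k then d else 0) * f k) =
    f i + (if i = 0 then 0 else d * f (i - 1))"
proof (cases i)
  case 0
  then have "(\<Sum>k\<in>{0..<n}. (if k = i then 1 else if i = Suc k then d else 0) * f k) =
      (\<Sum>k\<in>{0..<n}. if k = i then f k else 0)"
    by (intro sum.cong) auto
  then show ?thesis using 0 assms by simp
next
  case (Suc i')
  have "(\<Sum>k\<in>{0..<n}. (if k = i then 1 else if i = Suc k then d else 0) * f k) =
      (\<Sum>k\<in>{0..<n}. (if k = i then f k else 0) + (if k = i' then d * f k else 0))"
    using Suc by (intro sum.cong) auto
  then show ?thesis using Suc assms by (simp add: sum.distrib)
qed

lemma fps_const_hom: "comm_ring_hom (fps_const :: 'a::comm_ring_1 \<Rightarrow> 'a fps)"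
  by unfold_locales simp_all

lemma schur_det_const: "Determinant.det (mat n n (\<lambda>(i, j). fps_const (flag_entry a x n (b i) (Suc j)))) = fps_const (schur_det a x n b)"
proof -
  have "mat n n (\<lambda>(i, j). fps_const (flag_entry a x n (b i) (Suc j))) =
      map_mat fps_const (mat n n (\<lambda>(i, j). flag_entry a x n (b i) (Suc j)))"
    by (rule eq_matI) auto
  then show ?thesis
    by (simp only: schur_det_def comm_ring_hom.hom_det[OF fps_const_hom])
qed

text \<open>\<open>Kf i\<close> cuts the expansion of row \<open>i\<close> where it reaches row
  \<open>i - 1\<close>, so the remainder is a multiple of that row and is produced by the
  unitriangular row operation \<open>L\<close>. Hence \<open>Wt * C\<close> and \<open>L * M\<close>
  have congruent determinants, where \<open>C\<close> is \<open>1 - t X\<close> on columns and has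
  the product of the \<open>lin (x j)\<close> as determinant. \<open>N\<close> is later the
  numerator.\<close>

lemma pieri:
  fixes a :: "int \<Rightarrow> 'a::comm_ring_1" and x :: "nat \<Rightarrow> 'a"
  assumes b: "\<And>i. i < n \<Longrightarrow> - int n \<le> b i" and dec: "\<And>i. Suc i < n \<Longrightarrow> b (Suc i) \<le> b i"
    and r: "r < K"
  defines "Kf \<equiv> \<lambda>i. if i = 0 then K else nat (b (i - 1) - b i)"
  shows "fps_nth (N * geo_prod x {1..n}) r * schur_det a x n b =
    (\<Sum>f\<in>Pi\<^sub>E {0..<n} (\<lambda>i. {..<Kf i}).
      fps_nth (N * (\<Prod>i=0..<n. fps_X ^ f i * geo_run a (b i) (Suc (f i)))) r * schur_det a x n (\<lambda>i. b i + int (f i)))"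
proof -
  \<comment> \<open>Row 0 has no previous row at which to cut, so its expansion is truncated at order \<open>K\<close> in \<open>t\<close>.\<close>
  define w where "w = (\<lambda>i j. \<Sum>k<Kf i. fps_X ^ k * geo_run a (b i) (Suc k) * fps_const (flag_entry a x n (b i + int k) j))"
  define Wt where "Wt = mat n n (\<lambda>(i, j). w i (Suc j))"
  define C where "C = mat n n (\<lambda>(k, j). if k = j then lin (x (Suc j)) else if k = Suc j then - fps_X else 0)"
  define M where "M = mat n n (\<lambda>(i, j). fps_const (flag_entry a x n (b i) (Suc j)))"
  define d where "d = (\<lambda>i. - (fps_X ^ Kf i * geo_run a (b i) (Kf i)))"
  define L where "L = mat n n (\<lambda>(i, k). if k = i then 1 else if i = Suc k then d i else 0)"
  define R where "R = (\<lambda>i j. fps_const (flag_entry a x n (b i) (Suc j)) + d i * fps_const (flag_entry a x n (b i + int (Kf i)) (Suc j)))"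
  have carr: "Wt \<in> carrier_mat n n" "C \<in> carrier_mat n n" "M \<in> carrier_mat n n" "L \<in> carrier_mat n n"
    by (auto simp: Wt_def C_def M_def L_def)
  have "Determinant.det C = prod_list (diag_mat C)"
    by (rule det_lower_triangular[OF _ carr(2)]) (auto simp: C_def)
  also have "\<dots> = (\<Prod>j=0..<n. lin (x (Suc j)))"
    unfolding prod_list_diag_prod by (intro prod.cong) (auto simp: C_def)
  also have "\<dots> = (\<Prod>j\<in>{1..n}. lin (x j))"
    by (rule prod.reindex_bij_witness[of _ "\<lambda>j. j - 1" Suc]) auto
  finally have detC: "Determinant.det C * geo_prod x {1..n} = 1"
    by (simp add: geo_prod_def flip: prod.distrib)
  have "Determinant.det L = prod_list (diag_mat L)"
    by (rule det_lower_triangular[OF _ carr(4)]) (auto simp: L_def)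
  also have "\<dots> = 1"
    unfolding L_def by (rule prod_list_diag_eq_1) simp
  finally have detL: "Determinant.det L = 1" .
  have WC: "Wt * C = mat n n (\<lambda>(i, j). R i j)"
  proof (rule eq_matI)
    fix i j assume "i < dim_row (mat n n (\<lambda>(i, j). R i j))" "j < dim_col (mat n n (\<lambda>(i, j). R i j))"
    then have i: "i < n" and j: "j < n" by auto
    \<comment> \<open>The right neighbour of the last column is outside the matrix, but its entries
      vanish.\<close>
    have 0: "w i (Suc (Suc j)) = 0" if "Suc j = n"
      unfolding w_def that using b[OF i] by (intro sum.neutral) (simp add: flag_entry_last)
    have "(Wt * C) $$ (i, j) = (\<Sum>k\<in>{0..<n}. w i (Suc k) *
        (if k = j then lin (x (Suc j)) else if k = Suc j then - fps_X else 0))"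
      using i j by (simp add: Wt_def C_def scalar_prod_def)
    also have "\<dots> = (\<Sum>k\<in>{0..<n}. (if k = j then lin (x (Suc j)) * w i (Suc j) else 0) +
        (if k = Suc j then - fps_X * w i (Suc (Suc j)) else 0))"
      by (intro sum.cong) (auto simp: mult_ac)
    also have "\<dots> = lin (x (Suc j)) * w i (Suc j) - fps_X * w i (Suc (Suc j))"
      using j 0 by (cases "Suc j < n") (auto simp: sum.distrib less_Suc_eq)
    also have "\<dots> = R i j"
      unfolding w_def R_def d_def using b[OF i] j by (subst telescope) auto
    finally show "(Wt * C) $$ (i, j) = mat n n (\<lambda>(i, j). R i j) $$ (i, j)"
      using i j by simp
  qed (auto simp: Wt_def C_def)
  have LM: "L * M = mat n n (\<lambda>(i, j). (fps_const (flag_entry a x n (b i) (Suc j)) +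
      (if i = 0 then 0 else d i * fps_const (flag_entry a x n (b (i - 1)) (Suc j)))))"
    by (rule eq_matI) (auto simp: L_def M_def scalar_prod_def sum_two_deltas)
  \<comment> \<open>The rows after row 0 agree exactly; row 0 agrees up to a remainder with the
    factor \<open>fps_X ^ K\<close>.\<close>
  have up: "eq_upto K (Determinant.det (Wt * C)) (Determinant.det (L * M))"
    unfolding WC LM
  proof (rule eq_upto_det)
    fix i j assume i: "i < n" and "j < n"
    show "eq_upto K (R i j) (fps_const (flag_entry a x n (b i) (Suc j)) +
      (if i = 0 then 0 else d i * fps_const (flag_entry a x n (b (i - 1)) (Suc j))))"
    proof (cases i)
      case 0
      then show ?thesis
        by (auto simp: eq_upto_def R_def d_def Kf_def mult.assoc fps_X_power_mult_nth)
    next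
      case (Suc i')
      then have "b i + int (Kf i) = b (i - 1)"
        using dec[of i'] i by (simp add: Kf_def)
      then show ?thesis using Suc by (simp add: R_def)
    qed
  qed
  have "Determinant.det (Wt * C) = Determinant.det Wt * Determinant.det C"
    by (rule det_mult) (use carr in auto)
  moreover have "Determinant.det (L * M) = fps_const (schur_det a x n b)"
    unfolding det_mult[OF carr(4,3)] detL by (simp add: M_def schur_det_const)
  ultimately have "eq_upto K (N * geo_prod x {1..n} * (Determinant.det Wt * Determinant.det C))
      (N * geo_prod x {1..n} * fps_const (schur_det a x n b))"
    using up by (auto intro: eq_upto_mult)
  also have "N * geo_prod x {1..n} * (Determinant.det Wt * Determinant.det C) =
      N * Determinant.det Wt * (Determinant.det C * geo_prod x {1..n})"
    by (simp only: mult_ac)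
  finally have "fps_nth (N * geo_prod x {1..n}) r * schur_det a x n b = fps_nth (N * Determinant.det Wt) r"
    using r unfolding detC eq_upto_def by simp
  also have "Determinant.det Wt = (\<Sum>f\<in>Pi\<^sub>E {0..<n} (\<lambda>i. {..<Kf i}).
      (\<Prod>i=0..<n. fps_X ^ f i * geo_run a (b i) (Suc (f i))) * fps_const (schur_det a x n (\<lambda>i. b i + int (f i))))"
    unfolding Wt_def w_def by (subst det_sum_rows) (simp_all add: schur_det_const)
  finally show ?thesis
    by (simp add: sum_distrib_left fps_sum_nth flip: mult.assoc)
qed

section \<open>Vanishing and linear independence\<close>

lemma lin_prod_geo_prod_cancel:
  assumes "finite S" "inj_on y S" "y ` S \<subseteq> {lo..hi}" "\<And>k. k \<in> S \<Longrightarrow> x k = a (y k)"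
  shows "lin_prod a lo hi * geo_prod x S = (\<Prod>k\<in>{lo..hi} - y ` S. lin (a k))"
proof -
  have "lin_prod a lo hi = (\<Prod>k\<in>{lo..hi} - y ` S. lin (a k)) * (\<Prod>k\<in>y ` S. lin (a k))"
    unfolding lin_prod_def using assms(3) by (intro prod.subset_diff) auto
  moreover have "(\<Prod>k\<in>y ` S. lin (a k)) * geo_prod x S = 1"
    unfolding geo_prod_def prod.reindex[OF assms(2)] using assms(4) by (simp flip: prod.distrib)
  ultimately show ?thesis by (simp add: mult.assoc)
qed

text \<open>After cancellation \<open>b + j - 1\<close> linear factors remain, one too few for the
  coefficient at \<open>b + int j\<close>.\<close>

lemma flag_entry_vanish:
  assumes "j \<le> n" "inj_on y {j..n}" "y ` {j..n} \<subseteq> {1 - b..int n}" "\<And>k. k \<in> {j..n} \<Longrightarrow> x k = a (y k)"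
  shows "flag_entry a x n b j = 0"
proof -
  let ?T = "{1 - b..int n} - y ` {j..n}"
  have c: "card (y ` {j..n}) = n + 1 - j"
    using assms by (simp add: card_image)
  \<comment> \<open>The comparison forces \<open>b + int j > 0\<close>, so that the subtractions of
    natural numbers below are exact.\<close>
  have "card (y ` {j..n}) \<le> card {1 - b..int n}"
    by (rule card_mono) (use assms in auto)
  then have le: "n + 1 - j \<le> nat (int n + b)" unfolding c by simp
  have T: "card ?T = nat (int n + b) - (n + 1 - j)"
    using assms(3) by (subst card_Diff_subset) (simp_all add: c)
  have "flag_entry a x n b j = coeff_int (\<Prod>k\<in>?T. lin (a k)) (b + int j)"
    unfolding flag_entry_def using assms by (subst lin_prod_geo_prod_cancel) auto
  also have "\<dots> = 0"
    unfolding coeff_int_def using le assms(1) by (auto intro!: prod_lin_nth_eq_0 simp: T)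
  finally show ?thesis .
qed

text \<open>The coefficient is the alternating sum of the elementary symmetric functions of the
  \<open>f k\<close> times powers of \<open>y\<close>. In the induction, \<open>lin y * P\<close>
  has degree at most \<open>card T\<close>, so the next coefficient of \<open>P\<close> is
  \<open>y\<close> times the one at \<open>card T\<close>.\<close>

lemma geo_prod_lin_nth_card:
  assumes "finite T"
  shows "fps_nth (geo y * (\<Prod>k\<in>T. lin (f k))) (card T) = (\<Prod>k\<in>T. y - f k)"
  using assms
proof (induction T rule: finite_induct)
  case empty
  show ?case by (simp add: geo_def)
next
  case (insert t T)
  define P where "P = geo y * (\<Prod>k\<in>T. lin (f k))"
  have "lin y * P = (\<Prod>k\<in>T. lin (f k))"
    by (simp add: P_def flip: mult.assoc)
  then have "fps_nth (lin y * P) (Suc (card T)) = 0"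
    using insert.hyps by (simp add: prod_lin_nth_eq_0)
  then have "fps_nth P (Suc (card T)) = y * fps_nth P (card T)"
    by (simp add: lin_nth)
  then have "fps_nth (lin (f t) * P) (Suc (card T)) = (y - f t) * fps_nth P (card T)"
    by (simp add: lin_nth left_diff_distrib)
  moreover have "fps_nth P (card T) = (\<Prod>k\<in>T. y - f k)"
    using insert.IH by (simp add: P_def)
  moreover have eq: "geo y * (\<Prod>k\<in>insert t T. lin (f k)) = lin (f t) * P"
    using insert.hyps by (simp add: P_def mult_ac)
  ultimately show ?case
    unfolding eq card_insert_disjoint[OF insert.hyps] prod.insert[OF insert.hyps] by simp
qed

text \<open>The later variables cancel, while the index of \<open>x j = a (- b)\<close> lies just
  below the interval and survives; \<open>geo_prod_lin_nth_card\<close> evaluates what is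
  left.\<close>

lemma flag_entry_diag:
  assumes "j \<le> n" "inj_on y {Suc j..n}" "y ` {Suc j..n} \<subseteq> {1 - b..int n}"
    "\<And>k. k \<in> {Suc j..n} \<Longrightarrow> x k = a (y k)" "x j = a (- b)" "0 \<le> b + int j"
  shows "flag_entry a x n b j = (\<Prod>k\<in>{1 - b..int n} - y ` {Suc j..n}. a (- b) - a k)"
proof -
  let ?T = "{1 - b..int n} - y ` {Suc j..n}"
  have c: "card (y ` {Suc j..n}) = n - j"
    using assms by (simp add: card_image)
  have T: "card ?T = nat (b + int j)"
    using assms(1,3,6) by (subst card_Diff_subset) (simp_all add: c)
  have "{j..n} = insert j {Suc j..n}" using assms(1) by auto
  then have "lin_prod a (1 - b) (int n) * geo_prod x {j..n} = geo (x j) * (lin_prod a (1 - b) (int n) * geo_prod x {Suc j..n})"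
    by (simp add: geo_prod_def mult_ac)
  also have "\<dots> = geo (a (- b)) * (\<Prod>k\<in>?T. lin (a k))"
    using assms by (subst lin_prod_geo_prod_cancel) auto
  finally have "flag_entry a x n b j = fps_nth (geo (a (- b)) * (\<Prod>k\<in>?T. lin (a k))) (card ?T)"
    using assms(6) by (simp add: flag_entry_def coeff_int_def T)
  then show ?thesis by (simp only: geo_prod_lin_nth_card finite_Diff finite_atLeastAtMost_int)
qed

text \<open>The first \<open>m + 1\<close> rows live in \<open>m\<close> columns, so by the
  pigeonhole principle every permutation meets the zero block.\<close>

lemma det_zero_block:
  fixes E :: "nat \<Rightarrow> nat \<Rightarrow> 'a::comm_ring_1"
  assumes "m < n" and z: "\<And>i j. i \<le> m \<Longrightarrow> m \<le> j \<Longrightarrow> j < n \<Longrightarrow> E i j = 0"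
  shows "Determinant.det (mat n n (\<lambda>(i, j). E i j)) = 0"
proof -
  have "mat n n (\<lambda>(i, j). E i j) \<in> carrier_mat n n" by auto
  note det_def'[OF this]
  moreover have "(\<Prod>i=0..<n. mat n n (\<lambda>(i, j). E i j) $$ (i, q i)) = 0" if q: "q permutes {0..<n}" for q
  proof -
    have "\<exists>i\<le>m. m \<le> q i"
    proof (rule ccontr)
      assume "\<not> ?thesis"
      then have "q ` {..m} \<subseteq> {..<m}" by force
      then have "card {..m} \<le> card {..<m}"
        by (rule card_inj_on_le[rotated]) (use permutes_inj_on[OF q] in auto)
      then show False by simp
    qed
    then obtain i where i: "i \<le> m" "m \<le> q i" by auto
    moreover have "q i < n" using permutes_in_image[OF q, of i] i assms(1) by simp
    ultimately show ?thesis
      using assms(1) by (intro prod_zero) (auto intro!: bexI[of _ i] z)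
  qed
  ultimately show ?thesis by simp
qed

section \<open>Evaluation at the points attached to partitions\<close>

lemma partition_antimono: "is_partition \<mu> \<Longrightarrow> 1 \<le> i \<Longrightarrow> i \<le> j \<Longrightarrow> \<mu> j \<le> \<mu> i"
proof (induction j)
  case (Suc j)
  show ?case
  proof (cases "i = Suc j")
    case False
    then have "\<mu> (j + 1) \<le> \<mu> j"
      using Suc.prems unfolding is_partition_def by (meson le_SucE order_trans)
    then show ?thesis using Suc False by simp
  qed simp
qed simp

lemma composition_zero_beyond_len: "is_composition \<mu> \<Longrightarrow> len \<mu> < i \<Longrightarrow> \<mu> i = 0"
  unfolding is_composition_def len_def by (rule ccontr) (force dest: Max_ge[rotated])

text \<open>The index of the value given to \<open>x_k\<close>. It is the negative of
  \<open>shifted_part \<kappa> (k - 1)\<close>, as \<open>flag_entry_diag\<close> requires on the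
  diagonal.\<close>

definition spec_point :: "(nat \<Rightarrow> nat) \<Rightarrow> nat \<Rightarrow> int" where
  "spec_point \<kappa> k = int k - int (\<kappa> k)"

lemma spec_point_less:
  assumes "is_partition \<kappa>" "1 \<le> i" "i < j"
  shows "spec_point \<kappa> i < spec_point \<kappa> j"
  using partition_antimono[OF assms(1), of i j] assms by (simp add: spec_point_def)

lemma inj_on_spec_point: "is_partition \<kappa> \<Longrightarrow> inj_on (spec_point \<kappa>) {Suc j..n}"
  using spec_point_less[of \<kappa>] by (intro linorder_inj_onI) (auto simp: less_le)

text \<open>Rows up to \<open>i\<^sub>0 - 1\<close> and columns from \<open>i\<^sub>0 - 1\<close>
  on, counted from 0, form a zero block: for \<open>k \<ge> i\<^sub>0\<close>, the chain
  \<open>\<kappa> k \<le> \<kappa> i\<^sub>0 < \<kappa>' i\<^sub>0 \<le> \<kappa>' (Suc i)\<close>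
  puts each specialized index into the numerator interval of row \<open>i\<close>.\<close>

lemma schur_det_vanish:
  assumes "is_partition \<kappa>" "is_partition \<kappa>'" "1 \<le> i\<^sub>0" "i\<^sub>0 \<le> n" "\<kappa> i\<^sub>0 < \<kappa>' i\<^sub>0"
  shows "schur_det a (\<lambda>k. a (spec_point \<kappa> k)) n (shifted_part \<kappa>') = 0"
  unfolding schur_det_def
proof (rule det_zero_block)
  show "i\<^sub>0 - 1 < n" using assms by simp
  fix i j assume ij: "i \<le> i\<^sub>0 - 1" "i\<^sub>0 - 1 \<le> j" "j < n"
  show "flag_entry a (\<lambda>k. a (spec_point \<kappa> k)) n (shifted_part \<kappa>' i) (Suc j) = 0"
  proof (rule flag_entry_vanish)
    show "spec_point \<kappa> ` {Suc j..n} \<subseteq> {1 - shifted_part \<kappa>' i..int n}"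
    proof
      fix z assume "z \<in> spec_point \<kappa> ` {Suc j..n}"
      then obtain k where k: "z = spec_point \<kappa> k" "Suc j \<le> k" "k \<le> n" by auto
      have "\<kappa> k \<le> \<kappa> i\<^sub>0" by (rule partition_antimono) (use assms ij k in auto)
      moreover have "\<kappa>' i\<^sub>0 \<le> \<kappa>' (Suc i)" by (rule partition_antimono) (use assms ij in auto)
      ultimately show "z \<in> {1 - shifted_part \<kappa>' i..int n}"
        using assms ij k by (simp add: spec_point_def shifted_part_def)
    qed
  qed (use ij inj_on_spec_point[OF assms(1)] in auto)
qed

text \<open>At its own point the matrix is lower triangular by \<open>flag_entry_vanish\<close>, and
  its diagonal entries are products of differences of distinct values of \<open>a\<close>.\<close>

lemma schur_det_diag_nonzero:
  fixes a :: "int \<Rightarrow> 'a::idom"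
  assumes \<kappa>: "is_partition \<kappa>" and inj: "inj a"
  shows "schur_det a (\<lambda>k. a (spec_point \<kappa> k)) n (shifted_part \<kappa>) \<noteq> 0"
proof -
  let ?x = "\<lambda>k. a (spec_point \<kappa> k)"
  let ?M = "mat n n (\<lambda>(i, j). flag_entry a ?x n (shifted_part \<kappa> i) (Suc j))"
  have sub: "spec_point \<kappa> ` {Suc j..n} \<subseteq> {1 - shifted_part \<kappa> i..int n}" if "i < j" for i j
  proof
    fix z assume "z \<in> spec_point \<kappa> ` {Suc j..n}"
    then obtain k where k: "z = spec_point \<kappa> k" "Suc j \<le> k" "k \<le> n" by auto
    have "\<kappa> k \<le> \<kappa> (Suc i)" by (rule partition_antimono) (use \<kappa> that k in auto)
    then show "z \<in> {1 - shifted_part \<kappa> i..int n}"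
      using that k by (simp add: spec_point_def shifted_part_def)
  qed
  have "Determinant.det ?M = prod_list (diag_mat ?M)"
  proof (rule det_lower_triangular)
    fix i j assume ij: "i < j" "j < n"
    show "?M $$ (i, j) = 0"
      using ij flag_entry_vanish[of "Suc j" n "spec_point \<kappa>" "shifted_part \<kappa> i" ?x a] inj_on_spec_point[OF \<kappa>] sub[OF ij(1)] by auto
  qed auto
  also have "\<dots> = (\<Prod>i=0..<n. flag_entry a ?x n (shifted_part \<kappa> i) (Suc i))"
    unfolding prod_list_diag_prod by (intro prod.cong) auto
  also have "\<dots> \<noteq> 0"
  proof -
    have "flag_entry a ?x n (shifted_part \<kappa> i) (Suc i) \<noteq> 0" if "i < n" for i
    proof -
      have "flag_entry a ?x n (shifted_part \<kappa> i) (Suc i) =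
          (\<Prod>k\<in>{1 - shifted_part \<kappa> i..int n} - spec_point \<kappa> ` {Suc (Suc i)..n}. a (- shifted_part \<kappa> i) - a k)"
        by (rule flag_entry_diag) (use that inj_on_spec_point[OF \<kappa>] sub[of i "Suc i"] in \<open>auto simp: shifted_part_def spec_point_def\<close>)
      also have "\<dots> \<noteq> 0"
        using inj by (auto simp: inj_eq)
      finally show ?thesis .
    qed
    then show ?thesis by simp
  qed
  finally show ?thesis by (simp add: schur_det_def)
qed

lemma subst_x_schur_det: "subst_x g (schur_det xa xvar n b) = schur_det xa g n b"
proof -
  have "map_mat (subst_x g) (mat n n (\<lambda>(i, j). flag_entry xa xvar n (b i) (Suc j))) =
      mat n n (\<lambda>(i, j). flag_entry xa g n (b i) (Suc j))"
    by (rule eq_matI) (auto simp: flag_entry_def subst_x_coeff_int)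
  then show ?thesis
    unfolding schur_det_def comm_ring_hom.hom_det[OF subst_x_hom, symmetric] by simp
qed

lemma inj_avar: "inj avar"
proof (rule injI)
  fix i j assume "avar i = avar j"
  then have "Poly_Mapping.keys (avar i) = Poly_Mapping.keys (avar j)" by simp
  then have "Poly_Mapping.single i (1::nat) = Poly_Mapping.single j 1"
    by (simp add: avar_def)
  then have "Poly_Mapping.keys (Poly_Mapping.single i (1::nat)) = Poly_Mapping.keys (Poly_Mapping.single j (1::nat))" by simp
  then show "i = j" by simp
qed

lemma inj_xa: "inj xa"
proof (rule injI)
  fix i j assume "xa i = xa j"
  then have "xconst (avar i - avar j) = 0" by (simp add: xa_def xconst.hom_minus)
  then show "i = j" using inj_avar by (simp add: inj_eq)
qed

text \<open>Among the partitions with nonzero coefficient take one of least size and evaluate at its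
  point. By \<open>schur_det_vanish\<close> only partitions contained in it survive, and by
  minimality it alone does.\<close>

lemma schur_det_independent:
  assumes fin: "finite S" and S: "\<And>\<kappa>. \<kappa> \<in> S \<Longrightarrow> is_partition \<kappa> \<and> len \<kappa> \<le> n"
    and sum0: "(\<Sum>\<kappa>\<in>S. xconst (d \<kappa>) * schur_det xa xvar n (shifted_part \<kappa>)) = 0"
    and "\<kappa> \<in> S"
  shows "d \<kappa> = 0"
proof (rule ccontr)
  assume "d \<kappa> \<noteq> 0"
  let ?B = "{\<kappa> \<in> S. d \<kappa> \<noteq> 0}"
  let ?s = "\<lambda>\<kappa> :: nat \<Rightarrow> nat. \<Sum>i\<in>{1..n}. \<kappa> i"
  have "?B \<noteq> {}" using \<open>d \<kappa> \<noteq> 0\<close> assms(4) by auto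
  then obtain \<mu> where \<mu>: "\<mu> \<in> S" "d \<mu> \<noteq> 0" and min: "\<And>\<kappa>. \<kappa> \<in> ?B \<Longrightarrow> ?s \<mu> \<le> ?s \<kappa>"
    using ex_min_if_finite[of "?s ` ?B"] fin by (auto simp: not_less)
  have other: "d \<kappa> = 0 \<or> schur_det xa (\<lambda>k. xa (spec_point \<mu> k)) n (shifted_part \<kappa>) = 0" if "\<kappa> \<in> S" "\<kappa> \<noteq> \<mu>" for \<kappa>
  proof (rule disjCI)
    assume nz: "schur_det xa (\<lambda>k. xa (spec_point \<mu> k)) n (shifted_part \<kappa>) \<noteq> 0"
    then have le: "\<kappa> i \<le> \<mu> i" if "i \<in> {1..n}" for i
      using schur_det_vanish[of \<mu> \<kappa> i n xa] S \<mu> \<open>\<kappa> \<in> S\<close> that by force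
    show "d \<kappa> = 0"
    proof (rule ccontr)
      assume "d \<kappa> \<noteq> 0"
      then have "?s \<mu> \<le> ?s \<kappa>" using min that by auto
      moreover have "?s \<kappa> \<le> ?s \<mu>" by (rule sum_mono) (use le in auto)
      ultimately have "?s \<kappa> = ?s \<mu>" by simp
      then have eq: "\<kappa> i = \<mu> i" if "i \<in> {1..n}" for i
        using sum_mono_inv[of \<kappa> "{1..n}" \<mu> i] le that by simp
      have "\<kappa> i = \<mu> i" for i
        using eq[of i] composition_zero_beyond_len[of \<kappa> i] composition_zero_beyond_len[of \<mu> i]
          S[OF \<mu>(1)] S[OF \<open>\<kappa> \<in> S\<close>]
        by (cases "i = 0"; cases "i \<le> n") (auto simp: is_partition_def is_composition_def)
      then show False using \<open>\<kappa> \<noteq> \<mu>\<close> by auto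
    qed
  qed
  interpret sx: comm_ring_hom "subst_x (\<lambda>k. xa (spec_point \<mu> k))" by (rule subst_x_hom)
  have "0 = subst_x (\<lambda>k. xa (spec_point \<mu> k)) (\<Sum>\<kappa>\<in>S. xconst (d \<kappa>) * schur_det xa xvar n (shifted_part \<kappa>))"
    by (simp add: sum0)
  also have "\<dots> = (\<Sum>\<kappa>\<in>S. xconst (d \<kappa>) * schur_det xa (\<lambda>k. xa (spec_point \<mu> k)) n (shifted_part \<kappa>))"
    by (simp add: sx.hom_sum sx.hom_mult subst_x_schur_det)
  also have "\<dots> = (\<Sum>\<kappa>\<in>{\<mu>}. xconst (d \<kappa>) * schur_det xa (\<lambda>k. xa (spec_point \<mu> k)) n (shifted_part \<kappa>))"
    by (rule sum.mono_neutral_right) (use fin \<mu> other in \<open>auto simp: xconst.hom_zero\<close>)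
  finally show False
    using \<mu> schur_det_diag_nonzero[OF _ inj_xa, of \<mu> n] S by simp
qed

section \<open>Generating functions of fillings of a row\<close>

lemma apply_word_Nil [simp]: "apply_word \<rho> [] = \<rho>"
  by (simp add: apply_word_def)

lemma apply_word_Cons [simp]: "apply_word \<rho> (s # S) = apply_word (\<rho>(s := \<rho> s + 1)) S"
  by (simp add: apply_word_def)

lemma apply_word_count: "apply_word \<rho> S k = \<rho> k + count_list S k"
  by (induction S arbitrary: \<rho>) auto

definition barred_entries :: "entry list \<Rightarrow> nat list" where
  "barred_entries es = map val (filter (\<lambda>x. \<not> is_Unbarred x) es)"

lemma barred_entries_simps [simp]:
  "barred_entries [] = []"
  "barred_entries (Unbarred v # es) = barred_entries es"
  "barred_entries (Barred v # es) = v # barred_entries es"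
  by (simp_all add: barred_entries_def)

text \<open>\<open>\<rho>\<close> is the composition created before the first entry and
  \<open>c\<close> is minus the content of the box of that entry.\<close>

fun weight :: "(int \<Rightarrow> 'a::comm_ring_1) \<Rightarrow> (nat \<Rightarrow> nat) \<Rightarrow> int \<Rightarrow> entry list \<Rightarrow> 'a" where
  "weight a \<rho> c [] = 1"
| "weight a \<rho> c (Unbarred v # es) = (a (int v - int (\<rho> v)) - a (int v + c)) * weight a \<rho> (c - 1) es"
| "weight a \<rho> c (Barred v # es) = weight a (\<rho>(v := \<rho> v + 1)) (c - 1) es"

text \<open>The bound \<open>n\<close> makes sums over rows finite. The Yamanouchi condition enters
  later, through horizontal strips.\<close>

definition fillings :: "nat \<Rightarrow> (nat \<Rightarrow> nat) \<Rightarrow> (nat \<Rightarrow> nat) \<Rightarrow> nat \<Rightarrow> entry list set" where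
  "fillings n \<rho> \<nu> r = {es. length es = r \<and> (\<forall>x\<in>set es. val x \<in> {1..n}) \<and>
     sorted_wrt (\<lambda>x y. val y \<le> val x) es \<and> apply_word \<rho> (barred_entries es) = \<nu>}"

lemma finite_entries: "finite {x. val x \<in> {1..n}}"
proof -
  have "{x. val x \<in> {1..n}} \<subseteq> Unbarred ` {1..n} \<union> Barred ` {1..n}"
  proof
    fix x assume "x \<in> {x. val x \<in> {1..n}}"
    then show "x \<in> Unbarred ` {1..n} \<union> Barred ` {1..n}" by (cases x) auto
  qed
  then show ?thesis by (rule finite_subset) auto
qed

lemma finite_fillings [simp]: "finite (fillings n \<rho> \<nu> r)"
  by (rule finite_subset[OF _ finite_lists_length_eq[OF finite_entries[of n], of r]])
    (auto simp: fillings_def)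

lemma fillings_0: "fillings n \<rho> \<nu> 0 = (if \<rho> = \<nu> then {[]} else {})"
  by (auto simp: fillings_def)

lemma fillings_Suc_0: "fillings 0 \<rho> \<nu> (Suc r) = {}"
  by (auto simp: fillings_def length_Suc_conv)

lemma fillings_Suc_Suc:
  "fillings (Suc n) \<rho> \<nu> (Suc r) = fillings n \<rho> \<nu> (Suc r) \<union>
     (#) (Unbarred (Suc n)) ` fillings (Suc n) \<rho> \<nu> r \<union>
     (#) (Barred (Suc n)) ` fillings (Suc n) (\<rho>(Suc n := \<rho> (Suc n) + 1)) \<nu> r"
  (is "?L = ?R")
proof
  show "?L \<subseteq> ?R"
  proof
    fix es assume es: "es \<in> ?L"
    then obtain x fs where [simp]: "es = x # fs" by (cases es) (auto simp: fillings_def)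
    show "es \<in> ?R"
    proof (cases "val x = Suc n")
      case True
      with es show ?thesis by (cases x) (auto simp: fillings_def)
    next
      case False
      with es have "val x \<le> n" by (auto simp: fillings_def)
      with es show ?thesis by (fastforce simp: fillings_def)
    qed
  qed
  show "?R \<subseteq> ?L" by (force simp: fillings_def)
qed

text \<open>An unbarred \<open>k\<close> met while row \<open>k\<close> has length \<open>m\<close>
  contributes \<open>a (int k - int m)\<close>; each length passed gives one factor, both ends
  included.\<close>

definition sites :: "(int \<Rightarrow> 'a::comm_ring_1) \<Rightarrow> nat \<Rightarrow> (nat \<Rightarrow> nat) \<Rightarrow> (nat \<Rightarrow> nat) \<Rightarrow> 'a fps" where
  "sites a n \<rho> \<nu> = (\<Prod>k\<in>{1..n}. \<Prod>m\<in>{\<rho> k..\<nu> k}. geo (a (int k - int m)))"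

lemma sites_nth_0 [simp]: "fps_nth (sites a n \<rho> \<nu>) 0 = 1"
  unfolding sites_def by (induction n) (simp_all add: fps_mult_nth_0)

definition skew_size :: "nat \<Rightarrow> (nat \<Rightarrow> nat) \<Rightarrow> (nat \<Rightarrow> nat) \<Rightarrow> nat" where
  "skew_size n \<rho> \<nu> = (\<Sum>k\<in>{1..n}. \<nu> k - \<rho> k)"

text \<open>The first entry is the largest: it is an unbarred \<open>?N\<close>, a barred
  \<open>?N\<close>, or at most \<open>n\<close>. The last two cases together give a coefficient of
  \<open>lin y * F\<close>; the first contributes the difference with which
  \<open>coeff_int_exchange\<close> replaces \<open>lin y\<close> by the new top numerator
  factor.\<close>

lemma sum_fillings:
  assumes "\<rho> \<le> \<nu>" "\<And>k. k \<notin> {1..n} \<Longrightarrow> \<rho> k = \<nu> k"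
  shows "(\<Sum>es\<in>fillings n \<rho> \<nu> r. weight a \<rho> c es) =
    coeff_int (lin_prod a (c + 2 - int r) (c + int n) * sites a n \<rho> \<nu>) (int r - int (skew_size n \<rho> \<nu>))"
  using assms
proof (induction r arbitrary: n \<rho> c)
  case 0
  have "skew_size n \<rho> \<nu> = 0 \<longleftrightarrow> (\<forall>k\<in>{1..n}. \<nu> k \<le> \<rho> k)"
    by (simp add: skew_size_def)
  also have "\<dots> \<longleftrightarrow> \<rho> = \<nu>"
    using 0 by (auto simp: fun_eq_iff le_fun_def) (metis le_antisym atLeastAtMost_iff One_nat_def)
  finally show ?case
    by (cases "\<rho> = \<nu>") (simp_all add: fillings_0 fps_mult_nth_0)
next
  case (Suc r)
  note IHr = Suc.IH
  from Suc.prems show ?case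
  proof (induction n)
    case 0
    \<comment> \<open>Without letters the numerator has \<open>r\<close> factors, one too few for
      the coefficient at \<open>Suc r\<close>.\<close>
    have "coeff_int (lin_prod a (c + 2 - int (Suc r)) (c + int 0)) (int (Suc r)) = 0"
      by (rule coeff_int_lin_prod_eq_0) auto
    then show ?case by (simp add: fillings_Suc_0 sites_def skew_size_def)
  next
    case (Suc n)
    let ?N = "Suc n"
    define \<rho>' where "\<rho>' = \<rho>(?N := \<rho> ?N + 1)"
    define q where "q = skew_size ?N \<rho> \<nu>"
    define y where "y = a (int ?N - int (\<rho> ?N))"
    define F where "F = lin_prod a (c + 1 - int r) (c + int n) * sites a ?N \<rho> \<nu>"
    have le: "\<rho> ?N \<le> \<nu> ?N" using Suc.prems(1) by (simp add: le_fun_def)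
    have "(\<Sum>es\<in>fillings ?N \<rho> \<nu> (Suc r). weight a \<rho> c es) =
        (\<Sum>es\<in>fillings n \<rho> \<nu> (Suc r). weight a \<rho> c es) +
        (\<Sum>es\<in>(#) (Unbarred ?N) ` fillings ?N \<rho> \<nu> r. weight a \<rho> c es) +
        (\<Sum>es\<in>(#) (Barred ?N) ` fillings ?N \<rho>' \<nu> r. weight a \<rho> c es)"
      unfolding fillings_Suc_Suc \<rho>'_def[symmetric]
      by (subst sum.union_disjoint, simp, simp, fastforce simp: fillings_def)+ simp
    also have "(\<Sum>es\<in>(#) (Unbarred ?N) ` fillings ?N \<rho> \<nu> r. weight a \<rho> c es) =
        (y - a (c + int ?N)) * (\<Sum>es\<in>fillings ?N \<rho> \<nu> r. weight a \<rho> (c - 1) es)"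
      by (subst sum.reindex) (simp_all add: sum_distrib_left y_def add.commute)
    also have "(\<Sum>es\<in>fillings ?N \<rho> \<nu> r. weight a \<rho> (c - 1) es) = coeff_int F (int r - int q)"
      using IHr[OF Suc.prems, where c = "c - 1"] by (simp add: F_def q_def algebra_simps)
    also have "(\<Sum>es\<in>(#) (Barred ?N) ` fillings ?N \<rho>' \<nu> r. weight a \<rho> c es) =
        (\<Sum>es\<in>fillings ?N \<rho>' \<nu> r. weight a \<rho>' (c - 1) es)"
      by (subst sum.reindex) (simp_all add: \<rho>'_def)
    finally have split: "(\<Sum>es\<in>fillings ?N \<rho> \<nu> (Suc r). weight a \<rho> c es) =
        (\<Sum>es\<in>fillings n \<rho> \<nu> (Suc r). weight a \<rho> c es) + (y - a (c + int ?N)) * coeff_int F (int r - int q) +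
        (\<Sum>es\<in>fillings ?N \<rho>' \<nu> r. weight a \<rho>' (c - 1) es)" .
    have "(\<Sum>es\<in>fillings n \<rho> \<nu> (Suc r). weight a \<rho> c es) +
        (\<Sum>es\<in>fillings ?N \<rho>' \<nu> r. weight a \<rho>' (c - 1) es) = coeff_int (lin y * F) (int r - int q + 1)"
    \<comment> \<open>One of the two sums is empty: a complete row admits no barred
      \<open>?N\<close>, an incomplete one requires one. In both cases \<open>lin y\<close> removes
      the site of length \<open>\<rho> ?N\<close>.\<close>
    proof (cases "\<rho> ?N = \<nu> ?N")
      case True
      have "fillings ?N \<rho>' \<nu> r = {}"
      proof -
        have "apply_word \<rho>' S \<noteq> \<nu>" for S
          using apply_word_count[of \<rho>' S ?N] True by (auto simp: \<rho>'_def)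
        then show ?thesis by (simp add: fillings_def)
      qed
      moreover have "\<rho> k = \<nu> k" if "k \<notin> {1..n}" for k
        using Suc.prems(2)[of k] True that by (cases "k = ?N") auto
      note Suc.IH[OF Suc.prems(1) this]
      moreover have "skew_size n \<rho> \<nu> = q"
        using True by (simp add: q_def skew_size_def)
      moreover have "sites a ?N \<rho> \<nu> = geo y * sites a n \<rho> \<nu>"
        using True by (simp add: sites_def y_def mult.commute)
      then have "lin y * sites a ?N \<rho> \<nu> = sites a n \<rho> \<nu>"
        by (simp flip: mult.assoc)
      then have "lin y * F = lin_prod a (c + 1 - int r) (c + int n) * sites a n \<rho> \<nu>"
        by (simp only: F_def mult.left_commute[of "lin y"])
      ultimately show ?thesis by (simp add: algebra_simps)
    next
      case False
      then have less: "\<rho> ?N < \<nu> ?N" using le by simp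
      have "apply_word \<rho> (barred_entries es) \<noteq> \<nu>" if "\<forall>x\<in>set es. val x \<in> {1..n}" for es
      proof -
        have "count_list (barred_entries es) ?N = 0"
          using that by (subst count_list_0_iff) (force simp: barred_entries_def)
        then show ?thesis using apply_word_count[of \<rho> "barred_entries es" ?N] less by auto
      qed
      then have "fillings n \<rho> \<nu> (Suc r) = {}"
        by (auto simp: fillings_def)
      moreover have "\<rho>' \<le> \<nu>" "\<And>k. k \<notin> {1..?N} \<Longrightarrow> \<rho>' k = \<nu> k"
        using Suc.prems less by (auto simp: \<rho>'_def le_fun_def)
      note IH = IHr[where n = ?N and c = "c - 1", OF this]
      have size: "int (skew_size ?N \<rho>' \<nu>) = int q - 1"
      proof -
        have "(\<Sum>k\<in>{1..n}. \<nu> k - \<rho>' k) = (\<Sum>k\<in>{1..n}. \<nu> k - \<rho> k)"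
          by (rule sum.cong) (auto simp: \<rho>'_def)
        then show ?thesis using less by (simp add: q_def skew_size_def \<rho>'_def)
      qed
      have "(\<Sum>es\<in>fillings ?N \<rho>' \<nu> r. weight a \<rho>' (c - 1) es) =
          coeff_int (lin_prod a (c + 1 - int r) (c + int n) * sites a ?N \<rho>' \<nu>) (int r - int q + 1)"
        using IH unfolding size by (simp add: algebra_simps)
      moreover have "sites a ?N \<rho> \<nu> = geo y * sites a ?N \<rho>' \<nu>"
      proof -
        have "{\<rho> ?N..\<nu> ?N} = insert (\<rho> ?N) {\<rho>' ?N..\<nu> ?N}"
          using less by (auto simp: \<rho>'_def)
        then have "(\<Prod>m\<in>{\<rho> ?N..\<nu> ?N}. geo (a (int ?N - int m))) =
            geo y * (\<Prod>m\<in>{\<rho>' ?N..\<nu> ?N}. geo (a (int ?N - int m)))"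
          by (simp add: y_def \<rho>'_def)
        moreover have "(\<Prod>k\<in>{1..n}. \<Prod>m\<in>{\<rho>' k..\<nu> k}. geo (a (int k - int m))) =
            (\<Prod>k\<in>{1..n}. \<Prod>m\<in>{\<rho> k..\<nu> k}. geo (a (int k - int m)))"
          by (rule prod.cong) (auto simp: \<rho>'_def)
        ultimately show ?thesis by (simp add: sites_def mult_ac)
      qed
      then have "lin y * sites a ?N \<rho> \<nu> = sites a ?N \<rho>' \<nu>"
        by (simp flip: mult.assoc)
      then have "lin y * F = lin_prod a (c + 1 - int r) (c + int n) * sites a ?N \<rho>' \<nu>"
        by (simp only: F_def mult.left_commute[of "lin y"])
      ultimately show ?thesis by (simp add: algebra_simps)
    qed
    then have "(\<Sum>es\<in>fillings ?N \<rho> \<nu> (Suc r). weight a \<rho> c es) =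
        coeff_int (lin (a (c + int ?N)) * F) (int r - int q + 1)"
      unfolding split coeff_int_exchange[of "a (c + int ?N)" F _ y] by simp
    also have "lin (a (c + int ?N)) * F = lin_prod a (c + 2 - int (Suc r)) (c + int ?N) * sites a ?N \<rho> \<nu>"
      using lin_prod_upper[of "c + 2 - int (Suc r)" "c + int ?N" a] by (simp add: F_def mult.assoc algebra_simps)
    finally show ?case by (simp add: q_def algebra_simps)
  qed
qed

section \<open>The structure coefficients\<close>

text \<open>The skew shape is a horizontal strip: no column receives two boxes.\<close>

definition strip :: "(nat \<Rightarrow> nat) \<Rightarrow> (nat \<Rightarrow> nat) \<Rightarrow> bool" where
  "strip \<mu> \<nu> \<longleftrightarrow> \<mu> \<le> \<nu> \<and> (\<forall>k\<ge>1. \<nu> (k + 1) \<le> \<mu> k)"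

lemma len_le_iff:
  assumes "is_composition \<mu>"
  shows "len \<mu> \<le> n \<longleftrightarrow> (\<forall>i>n. \<mu> i = 0)"
proof
  show "len \<mu> \<le> n \<Longrightarrow> \<forall>i>n. \<mu> i = 0"
    using composition_zero_beyond_len[OF assms] by auto
  assume "\<forall>i>n. \<mu> i = 0"
  then have "i \<le> n" if "\<mu> i \<noteq> 0" for i using that by (meson not_le)
  then show "len \<mu> \<le> n"
    using assms by (simp add: len_def is_composition_def)
qed

lemma schur_det_cong: "(\<And>i. i < n \<Longrightarrow> b i = b' i) \<Longrightarrow> schur_det a x n b = schur_det a x n b'"
  unfolding schur_det_def by (rule arg_cong[of _ _ Determinant.det], rule eq_matI) auto

text \<open>The numerator starts at \<open>lo\<close>, which becomes
  \<open>2 - int p + int e\<close>; the skew size is the power of \<open>fps_X\<close> carried by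
  the row expansions.\<close>

definition pieri_coeff :: "(int \<Rightarrow> 'a::comm_ring_1) \<Rightarrow> int \<Rightarrow> nat \<Rightarrow> nat \<Rightarrow> (nat \<Rightarrow> nat) \<Rightarrow> (nat \<Rightarrow> nat) \<Rightarrow> 'a" where
  "pieri_coeff a lo n p \<mu> \<nu> = coeff_int (lin_prod a lo (int n) * sites a n \<mu> \<nu>) (int p - int (skew_size n \<mu> \<nu>))"

lemma hom_pieri_coeff: "xconst (pieri_coeff avar lo n p \<mu> \<nu>) = pieri_coeff xa lo n p \<mu> \<nu>"
proof -
  interpret F: comm_ring_hom "hom_fps xconst" by (rule xconst.hom_fps_hom)
  show ?thesis
    by (simp add: pieri_coeff_def xconst.hom_coeff_int F.hom_mult xconst.hom_fps_lin_prod sites_def F.hom_prod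
      xconst.hom_fps_geo xa_def[abs_def])
qed

text \<open>Row \<open>i\<close> stands for part \<open>Suc i\<close>: its run covers the lengths
  from the old part to the new one, and the powers of \<open>fps_X\<close> add up to the skew
  size.\<close>

lemma pieri_factor_eq:
  fixes a :: "int \<Rightarrow> 'a::comm_ring_1"
  assumes "\<And>k. k \<in> {1..n} \<Longrightarrow> \<nu> k = \<mu> k + f (k - 1)"
  shows "fps_nth (lin_prod a lo (int n) * (\<Prod>i=0..<n. fps_X ^ f i * geo_run a (shifted_part \<mu> i) (Suc (f i)))) p =
    pieri_coeff a lo n p \<mu> \<nu>"
proof -
  have g: "geo_run a (shifted_part \<mu> (k - 1)) (Suc (f (k - 1))) = (\<Prod>m\<in>{\<mu> k..\<nu> k}. geo (a (int k - int m)))"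
    if k: "k \<in> {1..n}" for k
    unfolding geo_run_def
    by (rule prod.reindex_bij_witness[of _ "\<lambda>m. m - \<mu> k" "\<lambda>m. m + \<mu> k"])
      (use assms[OF k] k in \<open>auto simp: shifted_part_def algebra_simps\<close>)
  have "(\<Prod>i=0..<n. fps_X ^ f i * geo_run a (shifted_part \<mu> i) (Suc (f i))) =
      (\<Prod>k\<in>{1..n}. fps_X ^ f (k - 1) * geo_run a (shifted_part \<mu> (k - 1)) (Suc (f (k - 1))))"
    by (rule prod.reindex_bij_witness[of _ "\<lambda>k. k - 1" Suc]) auto
  also have "\<dots> = (\<Prod>k\<in>{1..n}. fps_X ^ (\<nu> k - \<mu> k)) * sites a n \<mu> \<nu>"
    unfolding sites_def prod.distrib[symmetric]
    by (rule prod.cong) (use assms in \<open>auto simp: g simp del: One_nat_def\<close>)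
  also have "(\<Prod>k\<in>{1..n}. fps_X ^ (\<nu> k - \<mu> k)) = (fps_X :: 'a fps) ^ skew_size n \<mu> \<nu>"
    by (simp add: skew_size_def power_sum)
  finally have "lin_prod a lo (int n) * (\<Prod>i=0..<n. fps_X ^ f i * geo_run a (shifted_part \<mu> i) (Suc (f i))) =
      fps_X ^ skew_size n \<mu> \<nu> * (lin_prod a lo (int n) * sites a n \<mu> \<nu>)"
    by (simp only: mult_ac)
  then show ?thesis
    by (auto simp: pieri_coeff_def coeff_int_def fps_X_power_mult_nth nat_diff_distrib)
qed

text \<open>A choice function of \<open>pieri\<close> is a shape, \<open>f i\<close> being the
  number of boxes added to row \<open>Suc i\<close>. The cut \<open>Kf i\<close> at a lower row says
  \<open>\<nu> (k + 1) \<le> \<mu> k\<close>; the truncation order \<open>Suc p\<close> at row 0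
  gives the bound on \<open>\<nu> 1\<close>.\<close>

lemma pieri_double_schur:
  fixes a :: "int \<Rightarrow> 'a::comm_ring_1" and x :: "nat \<Rightarrow> 'a" and p :: nat
  assumes mu: "is_partition \<mu>" and l: "len \<mu> \<le> n"
  defines "S \<equiv> {\<nu>. is_partition \<nu> \<and> len \<nu> \<le> n \<and> strip \<mu> \<nu> \<and> \<nu> 1 \<le> \<mu> 1 + p}"
  shows "finite S"
    and "fps_nth (lin_prod a lo (int n) * geo_prod x {1..n}) p * schur_det a x n (shifted_part \<mu>) =
      (\<Sum>\<nu>\<in>S. pieri_coeff a lo n p \<mu> \<nu> * schur_det a x n (shifted_part \<nu>))"
proof -
  define Kf where "Kf = (\<lambda>i. if i = 0 then Suc p else nat (shifted_part \<mu> (i - 1) - shifted_part \<mu> i))"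
  define P where "P = Pi\<^sub>E {0..<n} (\<lambda>i. {..<Kf i})"
  define \<Phi> where "\<Phi> = (\<lambda>f k. if k \<in> {1..n} then \<mu> k + f (k - 1) else (0::nat))"
  define \<Psi> where "\<Psi> = (\<lambda>\<nu>. \<lambda>i\<in>{0..<n}. \<nu> (Suc i) - \<mu> (Suc i) :: nat)"
  have anti: "\<mu> (Suc k) \<le> \<mu> k" if "k \<ge> 1" for k
    using mu that by (simp add: is_partition_def)
  have mu0: "\<mu> k = 0" if "k \<notin> {1..n}" for k
    using mu l that composition_zero_beyond_len[of \<mu> k]
    by (cases "k = 0") (auto simp: is_partition_def is_composition_def)
  have bound: "\<mu> (Suc k) + f k \<le> \<mu> k" if "f \<in> P" "1 \<le> k" "k < n" for f k
  proof -
    have "f k < Kf k" using that by (auto simp: P_def PiE_def Pi_def)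
    then show ?thesis using that anti[of k] by (simp add: Kf_def shifted_part_def)
  qed
  have \<Phi>: "\<Phi> f \<in> S" if f: "f \<in> P" for f
  proof -
    have comp: "is_composition (\<Phi> f)"
      unfolding is_composition_def
      by (auto simp: \<Phi>_def intro!: finite_subset[of "{i. \<Phi> f i \<noteq> 0}" "{1..n}"] split: if_splits)
    have step: "\<Phi> f (k + 1) \<le> \<mu> k" if "k \<ge> 1" for k
      using bound[OF f that] that by (auto simp: \<Phi>_def)
    have ge: "\<mu> k \<le> \<Phi> f k" for k
      using mu0[of k] by (auto simp: \<Phi>_def)
    have "\<Phi> f (k + 1) \<le> \<Phi> f k" if "k \<ge> 1" for k
      using step[OF that] ge[of k] by (rule order_trans)
    then have "is_partition (\<Phi> f)"
      using comp by (simp add: is_partition_def)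
    moreover have "strip \<mu> (\<Phi> f)"
      using step ge by (simp add: strip_def le_fun_def)
    moreover have "len (\<Phi> f) \<le> n"
      unfolding len_le_iff[OF comp] by (simp add: \<Phi>_def)
    moreover have "\<Phi> f 1 \<le> \<mu> 1 + p"
    proof (cases "n = 0")
      case False
      then have "f 0 < Kf 0" using f by (auto simp: P_def PiE_def Pi_def)
      then show ?thesis using False by (simp add: \<Phi>_def Kf_def)
    qed (simp add: \<Phi>_def)
    ultimately show ?thesis by (simp add: S_def)
  qed
  have \<Psi>: "\<Psi> \<nu> \<in> P" "\<Phi> (\<Psi> \<nu>) = \<nu>" if "\<nu> \<in> S" for \<nu>
  proof -
    from that have \<nu>: "is_partition \<nu>" "len \<nu> \<le> n" "strip \<mu> \<nu>" "\<nu> 1 \<le> \<mu> 1 + p"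
      by (auto simp: S_def)
    have le: "\<mu> k \<le> \<nu> k" for k using \<nu>(3) by (simp add: strip_def le_fun_def)
    have "\<Psi> \<nu> i < Kf i" if "i < n" for i
    proof (cases i)
      case 0
      then show ?thesis using that \<nu>(4) by (simp add: \<Psi>_def Kf_def)
    next
      case (Suc k)
      then have "\<nu> (i + 1) \<le> \<mu> i" using \<nu>(3) by (simp add: strip_def)
      then show ?thesis using that Suc le[of "Suc i"] anti[of i] by (simp add: \<Psi>_def Kf_def shifted_part_def)
    qed
    then show "\<Psi> \<nu> \<in> P" by (auto simp: P_def \<Psi>_def)
    show "\<Phi> (\<Psi> \<nu>) = \<nu>"
    proof
      fix k show "\<Phi> (\<Psi> \<nu>) k = \<nu> k"
        using le[of k] \<nu>(1,2) composition_zero_beyond_len[of \<nu> k]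
        by (cases "k = 0") (auto simp: \<Phi>_def \<Psi>_def is_partition_def is_composition_def)
    qed
  qed
  have \<Psi>\<Phi>: "\<Psi> (\<Phi> f) = f" if "f \<in> P" for f
    using that by (auto simp: \<Psi>_def \<Phi>_def P_def fun_eq_iff PiE_def extensional_def)
  have bij: "bij_betw \<Phi> P S"
    by (rule bij_betw_byWitness[of _ \<Psi>]) (use \<Phi> \<Psi> \<Psi>\<Phi> in auto)
  have "finite P" unfolding P_def by (rule finite_PiE) auto
  then show "finite S" using bij bij_betw_finite by blast
  have "fps_nth (lin_prod a lo (int n) * geo_prod x {1..n}) p * schur_det a x n (shifted_part \<mu>) =
      (\<Sum>f\<in>P. fps_nth (lin_prod a lo (int n) * (\<Prod>i=0..<n. fps_X ^ f i * geo_run a (shifted_part \<mu> i) (Suc (f i)))) p *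
        schur_det a x n (\<lambda>i. shifted_part \<mu> i + int (f i)))"
    unfolding P_def Kf_def
  proof (rule pieri)
    show "shifted_part \<mu> (Suc i) \<le> shifted_part \<mu> i" for i
      using anti[of "Suc i"] by (simp add: shifted_part_def)
  qed (simp_all add: shifted_part_def)
  also have "\<dots> = (\<Sum>f\<in>P. pieri_coeff a lo n p \<mu> (\<Phi> f) * schur_det a x n (shifted_part (\<Phi> f)))"
  proof (rule sum.cong[OF refl])
    fix f
    have "fps_nth (lin_prod a lo (int n) * (\<Prod>i=0..<n. fps_X ^ f i * geo_run a (shifted_part \<mu> i) (Suc (f i)))) p =
        pieri_coeff a lo n p \<mu> (\<Phi> f)"
      by (rule pieri_factor_eq) (simp add: \<Phi>_def)
    moreover have "schur_det a x n (\<lambda>i. shifted_part \<mu> i + int (f i)) = schur_det a x n (shifted_part (\<Phi> f))"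
      by (rule schur_det_cong) (auto simp: shifted_part_def \<Phi>_def)
    ultimately show "fps_nth (lin_prod a lo (int n) * (\<Prod>i=0..<n. fps_X ^ f i * geo_run a (shifted_part \<mu> i) (Suc (f i)))) p *
        schur_det a x n (\<lambda>i. shifted_part \<mu> i + int (f i)) = pieri_coeff a lo n p \<mu> (\<Phi> f) * schur_det a x n (shifted_part (\<Phi> f))"
      by simp
  qed
  also have "\<dots> = (\<Sum>\<nu>\<in>S. pieri_coeff a lo n p \<mu> \<nu> * schur_det a x n (shifted_part \<nu>))"
    by (rule sum.reindex_bij_betw[OF bij])
  finally show "fps_nth (lin_prod a lo (int n) * geo_prod x {1..n}) p * schur_det a x n (shifted_part \<mu>) =
      (\<Sum>\<nu>\<in>S. pieri_coeff a lo n p \<mu> \<nu> * schur_det a x n (shifted_part \<nu>))" .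
qed

text \<open>One \<open>n\<close> beyond all lengths involved suffices: evaluated there, the given
  expansion and \<open>pieri_double_schur\<close> are combinations of the same determinants, and
  \<open>schur_det_independent\<close> compares them.\<close>

lemma coefficient_eq:
  assumes tau: "is_tau \<tau>" and mu: "is_partition \<mu>" and nu: "is_partition \<nu>"
    and fin: "finite {\<kappa>. c \<kappa> \<noteq> 0}" and part: "\<And>\<kappa>. c \<kappa> \<noteq> 0 \<Longrightarrow> is_partition \<kappa>"
    and exp: "h_shift \<tau> (int p) e * double_schur \<tau> \<mu> =
      (\<Sum>\<kappa> | c \<kappa> \<noteq> 0. scalar (c \<kappa>) * double_schur \<tau> \<kappa>)"
    and n: "e < n" "len \<mu> \<le> n" "len \<nu> \<le> n" "\<And>\<kappa>. c \<kappa> \<noteq> 0 \<Longrightarrow> len \<kappa> \<le> n"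
  shows "c \<nu> = (if strip \<mu> \<nu> then pieri_coeff avar (2 - int p + int e) n p \<mu> \<nu> else 0)"
proof -
  define lo where "lo = 2 - int p + int e"
  define S where "S = {\<kappa>. is_partition \<kappa> \<and> len \<kappa> \<le> n \<and> strip \<mu> \<kappa> \<and> \<kappa> 1 \<le> \<mu> 1 + p}"
  define g where "g = (\<lambda>\<kappa>. if \<kappa> \<in> S then pieri_coeff avar lo n p \<mu> \<kappa> else 0)"
  note P = pieri_double_schur[OF mu n(2), where p = p, folded S_def]
  have ds: "double_schur \<tau> \<kappa> n = schur_det xa xvar n (shifted_part \<kappa>)" if "is_partition \<kappa>" "len \<kappa> \<le> n" for \<kappa>
    by (rule double_schur_eq[OF tau]) (use that composition_zero_beyond_len in \<open>auto simp: is_partition_def\<close>)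
  let ?C = "{\<kappa>. c \<kappa> \<noteq> 0}"
  let ?schur_det = "\<lambda>\<kappa>. schur_det xa xvar n (shifted_part \<kappa>)"
  have "h_shift \<tau> (int p) e n = fps_nth (lin_prod xa lo (int n) * geo_prod xvar {1..n}) p"
    using h_shift_eq[OF tau, of "int p" e n] n(1) by (simp add: lo_def)
  then have "(h_shift \<tau> (int p) e * double_schur \<tau> \<mu>) n = (\<Sum>\<kappa>\<in>S. pieri_coeff xa lo n p \<mu> \<kappa> * ?schur_det \<kappa>)"
    using P(2)[of xa lo xvar] ds[OF mu n(2)] by simp
  also have "\<dots> = (\<Sum>\<kappa>\<in>S. xconst (g \<kappa>) * ?schur_det \<kappa>)"
    by (rule sum.cong) (simp_all add: g_def hom_pieri_coeff)
  also have "\<dots> = (\<Sum>\<kappa>\<in>S \<union> ?C. xconst (g \<kappa>) * ?schur_det \<kappa>)"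
    by (rule sum.mono_neutral_left) (use P(1) fin in \<open>auto simp: g_def\<close>)
  finally have 1: "(h_shift \<tau> (int p) e * double_schur \<tau> \<mu>) n = \<dots>" .
  have sum_apply: "(\<Sum>\<kappa>\<in>B. F \<kappa>) n = (\<Sum>\<kappa>\<in>B. F \<kappa> n)" for B and F :: "(nat \<Rightarrow> nat) \<Rightarrow> nat \<Rightarrow> xpoly"
    by (induction B rule: infinite_finite_induct) auto
  have "(\<Sum>\<kappa> | c \<kappa> \<noteq> 0. scalar (c \<kappa>) * double_schur \<tau> \<kappa>) n = (\<Sum>\<kappa>\<in>?C. xconst (c \<kappa>) * ?schur_det \<kappa>)"
    unfolding sum_apply by (rule sum.cong) (simp_all add: scalar_def ds part n(4))
  also have "\<dots> = (\<Sum>\<kappa>\<in>S \<union> ?C. xconst (c \<kappa>) * ?schur_det \<kappa>)"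
    by (rule sum.mono_neutral_left) (use P(1) fin in auto)
  finally have "(\<Sum>\<kappa>\<in>S \<union> ?C. xconst (c \<kappa> - g \<kappa>) * ?schur_det \<kappa>) = 0"
    using 1 unfolding exp by (simp add: xconst.hom_minus left_diff_distrib sum_subtractf)
  then have "c \<kappa> - g \<kappa> = 0" if "\<kappa> \<in> S \<union> ?C" for \<kappa>
    by (rule schur_det_independent[rotated 2]) (use that P(1) fin part n(4) in \<open>auto simp: S_def\<close>)
  then have "c \<nu> = g \<nu>"
    by (cases "\<nu> \<in> S \<union> ?C") (auto simp: g_def)
  \<comment> \<open>Strips with more than \<open>p\<close> boxes in row 1 lie outside
    \<open>S\<close>; there the formula also gives 0, the index being negative.\<close>
  moreover have "pieri_coeff avar lo n p \<mu> \<nu> = 0" if "strip \<mu> \<nu>" "\<nu> 1 > \<mu> 1 + p"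
  proof -
    have "1 \<in> {1..n}" using n(1) by simp
    then have "\<nu> 1 - \<mu> 1 \<le> skew_size n \<mu> \<nu>"
      unfolding skew_size_def by (intro member_le_sum) auto
    then show ?thesis using that(2) by (simp add: pieri_coeff_def)
  qed
  ultimately show ?thesis
    using nu n(3) by (auto simp: g_def S_def lo_def not_le)
qed

section \<open>Monomials free of variables with large index\<close>

lemma lookup_avar_mult:
  assumes "Poly_Mapping.lookup m k = 0"
  shows "Poly_Mapping.lookup (avar k * P) m = 0"
proof (rule ccontr)
  assume "Poly_Mapping.lookup (avar k * P) m \<noteq> 0"
  then have "m \<in> Poly_Mapping.keys (avar k * P)" by (simp add: in_keys_iff)
  then obtain l where "m = Poly_Mapping.single k 1 + l"
    using keys_mult[of "avar k" P] by (auto simp: avar_def split: if_splits)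
  then show False using assms by (simp add: lookup_add)
qed

text \<open>A further factor \<open>lin (avar k)\<close> with \<open>k > n\<close> changes
  coefficients by multiples of \<open>avar k\<close>, in which \<open>m\<close> does not
  occur.\<close>

lemma lookup_coeff_int_lin_prod_extend:
  assumes "lo \<le> int n + 1" "\<And>k. k \<in> Poly_Mapping.keys m \<Longrightarrow> k \<le> int n"
  shows "Poly_Mapping.lookup (coeff_int (lin_prod avar lo (int e + int n) * F) r) m =
    Poly_Mapping.lookup (coeff_int (lin_prod avar lo (int n) * F) r) m"
proof (induction e)
  case (Suc e)
  let ?k = "int (Suc e) + int n"
  have "?k \<notin> Poly_Mapping.keys m" using assms(2)[of ?k] by auto
  then have "Poly_Mapping.lookup (avar ?k * P) m = 0" for P
    by (intro lookup_avar_mult) (simp add: in_keys_iff)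
  moreover have "lin_prod avar lo ?k * F = lin (avar ?k) * (lin_prod avar lo (int e + int n) * F)"
    using lin_prod_upper[of lo ?k avar] assms(1) by (simp add: mult.assoc algebra_simps)
  ultimately show ?case
    using Suc by (simp only: coeff_int_lin lookup_minus)
qed simp

section \<open>Tableaux of single-row shape\<close>

lemma weight_eq_prod:
  "weight a \<rho> c es = (\<Prod>i | i < length es \<and> is_Unbarred (es ! i).
     a (int (val (es ! i)) - int (apply_word \<rho> (barred_entries (take (Suc i) es)) (val (es ! i)))) -
     a (int (val (es ! i)) + c - int i))"
proof -
  \<comment> \<open>The value 1 at barred positions gives a product over all positions, so that
    peeling off the first entry becomes an index shift.\<close>
  define f where "f = (\<lambda>\<rho> c es i. if is_Unbarred (es ! i) then
     a (int (val (es ! i)) - int (apply_word \<rho> (barred_entries (take (Suc i) es)) (val (es ! i)))) -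
     a (int (val (es ! i)) + c - int i) else 1)"
  have U: "f \<rho> c (Unbarred v # es) (Suc i) = f \<rho> (c - 1) es i" for \<rho> c v es i
    by (simp add: f_def algebra_simps)
  have B: "f \<rho> c (Barred v # es) (Suc i) = f (\<rho>(v := \<rho> v + 1)) (c - 1) es i" for \<rho> c v es i
    by (simp add: f_def algebra_simps)
  have "weight a \<rho> c es = (\<Prod>i<length es. f \<rho> c es i)"
  proof (induction es arbitrary: \<rho> c)
    case (Cons x es)
    show ?case
      unfolding length_Cons prod.lessThan_Suc_shift
    proof (cases x)
      case (Unbarred v)
      have "f \<rho> c (Unbarred v # es) 0 = a (int v - int (\<rho> v)) - a (int v + c)"
        by (simp add: f_def)
      then show "weight a \<rho> c (x # es) = f \<rho> c (x # es) 0 * (\<Prod>i<length es. f \<rho> c (x # es) (Suc i))"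
        unfolding Unbarred U by (simp add: Cons.IH)
    next
      case (Barred v)
      have "f \<rho> c (Barred v # es) 0 = 1"
        by (simp add: f_def)
      then show "weight a \<rho> c (x # es) = f \<rho> c (x # es) 0 * (\<Prod>i<length es. f \<rho> c (x # es) (Suc i))"
        by (simp only: Barred B weight.simps Cons.IH mult_1)
    qed
  qed simp
  also have "\<dots> = (\<Prod>i\<in>{i \<in> {..<length es}. is_Unbarred (es ! i)}.
     a (int (val (es ! i)) - int (apply_word \<rho> (barred_entries (take (Suc i) es)) (val (es ! i)))) -
     a (int (val (es ! i)) + c - int i))"
    unfolding f_def by (rule prod.inter_filter[symmetric]) simp
  finally show ?thesis by simp
qed

text \<open>Every intermediate shape lies between \<open>\<mu>\<close> and \<open>\<nu>\<close>,
  hence \<open>\<rho> (k + 1) \<le> \<nu> (k + 1) \<le> \<mu> k \<le> \<rho> k\<close>.\<close>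

lemma strip_imp_yamanouchi:
  assumes mu: "is_partition \<mu>" and nu: "is_partition \<nu>" and "strip \<mu> \<nu>" and w: "apply_word \<mu> w = \<nu>"
  shows "yamanouchi \<mu> w"
  unfolding yamanouchi_def
proof (intro allI impI)
  fix i
  define \<rho> where "\<rho> = apply_word \<mu> (take i w)"
  have ge: "\<mu> k \<le> \<rho> k" for k by (simp add: \<rho>_def apply_word_count)
  have le: "\<rho> k \<le> \<nu> k" for k
  proof -
    have "count_list w k = count_list (take i w) k + count_list (drop i w) k"
      by (metis append_take_drop_id count_list_append)
    then show ?thesis by (simp add: \<rho>_def apply_word_count flip: w)
  qed
  have "{k. \<rho> k \<noteq> 0} \<subseteq> {k. \<nu> k \<noteq> 0}" using le by (metis (mono_tags) Collect_mono le_zero_eq)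
  then have "is_composition \<rho>"
    using nu le[of 0] finite_subset by (auto simp: is_partition_def is_composition_def)
  moreover have "\<rho> (k + 1) \<le> \<rho> k" if "k \<ge> 1" for k
    using le[of "k + 1"] ge[of k] assms(3) that unfolding strip_def by (meson order_trans)
  ultimately show "is_partition (apply_word \<mu> (take i w))"
    by (simp add: is_partition_def \<rho>_def)
qed

text \<open>Stop the weakly decreasing word before its first letter at most \<open>k\<close>: every
  \<open>k + 1\<close> has been added and no \<open>k\<close> yet, so the partition condition at
  that moment is the strip inequality.\<close>

lemma yamanouchi_imp_strip:
  assumes y: "yamanouchi \<mu> w" and sorted: "sorted_wrt (\<lambda>x y. y \<le> x) w" and w: "apply_word \<mu> w = \<nu>"
  shows "strip \<mu> \<nu>"
proof -
  have "\<nu> (k + 1) \<le> \<mu> k" if "k \<ge> 1" for k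
  proof -
    let ?v = "takeWhile (\<lambda>x. k < x) w"
    have "is_partition (apply_word \<mu> (take (length ?v) w))"
      using y length_takeWhile_le[of "\<lambda>x. k < x" w] unfolding yamanouchi_def by blast
    then have "apply_word \<mu> ?v (k + 1) \<le> apply_word \<mu> ?v k"
      using that by (simp add: is_partition_def flip: takeWhile_eq_take)
    moreover have "count_list ?v k = 0"
      by (subst count_list_0_iff) (auto dest: set_takeWhileD)
    moreover have "count_list ?v (k + 1) = count_list w (k + 1)"
      using sorted by (induction w) (auto simp: count_list_0_iff intro!: sym[OF count_list_0_iff[THEN iffD2]])
    ultimately show ?thesis by (simp add: apply_word_count flip: w)
  qed
  then show ?thesis
    by (auto simp: strip_def le_fun_def apply_word_count simp flip: w)
qed

section \<open>Single-row tableaux as lists of entries\<close>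

definition row_entries :: "nat \<Rightarrow> nat \<Rightarrow> (nat \<times> nat \<Rightarrow> entry) \<Rightarrow> entry list" where
  "row_entries e p T = map (\<lambda>j. T (Suc e, j)) [1..<Suc p]"

lemma length_row_entries [simp]: "length (row_entries e p T) = p"
  by (simp add: row_entries_def)

lemma nth_row_entries [simp]: "i < p \<Longrightarrow> row_entries e p T ! i = T (Suc e, Suc i)"
  by (simp add: row_entries_def del: upt_Suc)

lemma barred_word_eq: "barred_word T bs = barred_entries (map T bs)"
  by (simp add: barred_word_def barred_entries_def filter_map comp_def)

locale single_row =
  fixes lam :: "nat \<Rightarrow> nat" and p e :: nat
  assumes p: "p \<ge> 1" and lam_eq: "lam = (\<lambda>i. if i = e + 1 then p else 0)"
begin

lemma diagram_row: "diagram lam = Pair (Suc e) ` {1..p}"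
  by (auto simp: diagram_def lam_eq split: if_splits)

lemma row_order_row: "row_order lam = map (Pair (Suc e)) [1..<Suc p]"
proof -
  have "{i. lam i \<noteq> 0} = {Suc e}" using p by (auto simp: lam_eq)
  then have "len lam = Suc e" by (simp add: len_def)
  moreover have "concat (map (\<lambda>i. map (Pair i) [1..<lam i + 1]) (rev [1..<Suc e])) = []"
    by (auto simp: lam_eq)
  moreover have "lam (Suc e) = p" by (simp add: lam_eq)
  ultimately show ?thesis by (simp add: row_order_def)
qed

lemma row_word_row: "row_word lam T = barred_entries (row_entries e p T)"
  by (simp add: row_word_def barred_word_eq row_order_row row_entries_def comp_def del: upt_Suc)

lemma row_word_upto_row:
  assumes "1 \<le> j" "j \<le> p"
  shows "row_word_upto lam T (Suc e, j) = barred_entries (take j (row_entries e p T))"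
proof -
  have "[1..<Suc p] = [1..<j] @ j # [Suc j..<Suc p]"
    using upt_add_eq_append[of 1 j "Suc p - j"] upt_conv_Cons[of j "Suc p"] assms by simp
  moreover have "takeWhile (\<lambda>j'. j' \<noteq> j) ([1..<j] @ j # [Suc j..<Suc p]) = [1..<j]"
    by (subst takeWhile_append2) auto
  ultimately have "takeWhile (\<lambda>b. b \<noteq> (Suc e, j)) (row_order lam) = map (Pair (Suc e)) [1..<j]"
    unfolding row_order_row takeWhile_map by (simp add: comp_def del: upt_Suc)
  moreover have "take j (row_entries e p T) = map (\<lambda>j. T (Suc e, j)) [1..<Suc j]"
    using assms by (simp add: row_entries_def take_map del: upt_Suc)
  ultimately show ?thesis
    using assms(1) by (simp add: row_word_upto_def barred_word_eq comp_def)
qed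

text \<open>The box at list position \<open>i\<close> has content \<open>i - e\<close>, so the
  offset \<open>c\<close> of \<open>weight\<close> starts at \<open>e\<close>.\<close>

lemma prod_unbarred_row:
  "(\<Prod>b\<in>unbarred_boxes lam T.
      a (int (val (T b)) - int (apply_word \<mu> (row_word_upto lam T b) (val (T b)))) -
      a (int (val (T b)) - box_content b)) = weight a \<mu> (int e) (row_entries e p T)"
  unfolding weight_eq_prod
  by (rule prod.reindex_bij_witness[of _ "\<lambda>i. (Suc e, Suc i)" "\<lambda>b. snd b - 1"])
    (auto simp: unbarred_boxes_def diagram_row row_word_upto_row box_content_def algebra_simps)

lemma reverse_tableaux_row:
  "T \<in> reverse_tableaux lam \<longleftrightarrow> T \<in> extensional (diagram lam) \<and>
     (\<forall>x\<in>set (row_entries e p T). 1 \<le> val x) \<and> sorted_wrt (\<lambda>x y. val y \<le> val x) (row_entries e p T)"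
proof -
  have tr: "transp (\<lambda>x y. val y \<le> val x)" by (auto simp: transp_def)
  have "(\<forall>i j. (i, j) \<in> diagram lam \<and> (i, j + 1) \<in> diagram lam \<longrightarrow> val (T (i, j + 1)) \<le> val (T (i, j))) \<longleftrightarrow>
      (\<forall>i. Suc i < p \<longrightarrow> val (T (Suc e, Suc (Suc i))) \<le> val (T (Suc e, Suc i)))" (is "?l = ?r")
  proof
    show "?l \<Longrightarrow> ?r" by (auto simp: diagram_row)
    assume r: ?r
    show ?l
    proof (intro allI impI)
      fix i j assume ij: "(i, j) \<in> diagram lam \<and> (i, j + 1) \<in> diagram lam"
      then obtain k where "j = Suc k" "i = Suc e" "Suc k < p" by (cases j) (auto simp: diagram_row)
      with r show "val (T (i, j + 1)) \<le> val (T (i, j))" by simp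
    qed
  qed
  moreover have "(\<forall>x\<in>set (row_entries e p T). 1 \<le> val x) \<longleftrightarrow> (\<forall>b\<in>diagram lam. 1 \<le> val (T b))"
    by (auto simp: row_entries_def diagram_row)
  ultimately show ?thesis
    unfolding reverse_tableaux_def sorted_wrt_iff_nth_Suc_transp[OF tr] by (auto simp: PiE_def Pi_def)
qed

lemma bij_betw_row_entries:
  "bij_betw (row_entries e p)
     {T \<in> reverse_tableaux lam. apply_word \<mu> (row_word lam T) = \<nu> \<and> (\<forall>b\<in>diagram lam. val (T b) \<le> n)}
     (fillings n \<mu> \<nu> p)"
proof (rule bij_betw_byWitness)
  \<comment> \<open>Restriction gives \<open>undefined\<close> off the diagram, as tableaux require;
    columns count from 1, list positions from 0.\<close>
  let ?g = "\<lambda>es. restrict (\<lambda>b. es ! (snd b - 1)) (diagram lam)"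
  let ?S = "{T \<in> reverse_tableaux lam. apply_word \<mu> (row_word lam T) = \<nu> \<and> (\<forall>b\<in>diagram lam. val (T b) \<le> n)}"
  have bd: "(\<forall>x\<in>set (row_entries e p T). val x \<le> n) \<longleftrightarrow> (\<forall>b\<in>diagram lam. val (T b) \<le> n)" for T
    by (auto simp: row_entries_def diagram_row)
  have inv: "row_entries e p (?g es) = es" if "es \<in> fillings n \<mu> \<nu> p" for es
    by (rule nth_equalityI) (use that in \<open>auto simp: fillings_def diagram_row\<close>)
  show "\<forall>T\<in>?S. ?g (row_entries e p T) = T"
  proof
    fix T assume "T \<in> ?S"
    then have ext: "T \<in> extensional (diagram lam)" by (simp add: reverse_tableaux_row)
    show "?g (row_entries e p T) = T"
      by (rule extensionalityI[OF _ ext]) (auto simp: diagram_row)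
  qed
  show "\<forall>es\<in>fillings n \<mu> \<nu> p. row_entries e p (?g es) = es"
    using inv by blast
  show "row_entries e p ` ?S \<subseteq> fillings n \<mu> \<nu> p"
    using bd by (auto simp: fillings_def reverse_tableaux_row row_word_row)
  show "?g ` fillings n \<mu> \<nu> p \<subseteq> ?S"
  proof
    fix T assume "T \<in> ?g ` fillings n \<mu> \<nu> p"
    then obtain es where es: "es \<in> fillings n \<mu> \<nu> p" "T = ?g es" by blast
    then have "row_entries e p T = es" "T \<in> extensional (diagram lam)"
      using inv[OF es(1)] by auto
    then show "T \<in> ?S"
      using es(1) bd[of T] by (auto simp: reverse_tableaux_row row_word_row fillings_def)
  qed
qed

lemma sorted_row_word: "T \<in> reverse_tableaux lam \<Longrightarrow> sorted_wrt (\<lambda>x y. y \<le> x) (row_word lam T)"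
  unfolding reverse_tableaux_row row_word_row barred_entries_def sorted_wrt_map
  by (intro sorted_wrt_filter) simp

end

section \<open>From bounded entries to the formal sum\<close>

lemma exists_bound:
  fixes m :: "int \<Rightarrow>\<^sub>0 nat"
  assumes "finite C"
  obtains n where "l \<le> n" "\<And>\<kappa>. \<kappa> \<in> C \<Longrightarrow> f \<kappa> \<le> n" "\<And>k. k \<in> Poly_Mapping.keys m \<Longrightarrow> k \<le> int n"
proof
  let ?n = "l + (\<Sum>\<kappa>\<in>C. f \<kappa>) + (\<Sum>k\<in>Poly_Mapping.keys m. nat k)"
  show "l \<le> ?n" by simp
  show "f \<kappa> \<le> ?n" if "\<kappa> \<in> C" for \<kappa>
    using member_le_sum[of \<kappa> C f] assms that by simp
  show "k \<le> int ?n" if "k \<in> Poly_Mapping.keys m" for k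
  proof -
    have "nat k \<le> (\<Sum>k\<in>Poly_Mapping.keys m. nat k)"
      by (rule member_le_sum) (use that in auto)
    then have "nat k \<le> ?n" by linarith
    then show ?thesis by (simp only: nat_le_iff)
  qed
qed

text \<open>Exponents are natural numbers, so the other boxes cannot cancel the contribution of
  \<open>b\<close>.\<close>

lemma in_keys_choice_monom:
  assumes "finite B" "b \<in> B"
  shows "(if b \<in> D then v b else u b) \<in> Poly_Mapping.keys (choice_monom u v B D)"
proof -
  have "choice_monom u v B D = Poly_Mapping.single (if b \<in> D then v b else u b) 1 +
      choice_monom u v (B - {b}) D"
    unfolding choice_monom_def using assms by (simp add: sum.remove)
  then show ?thesis by (simp add: in_keys_iff lookup_add)
qed

context single_row
begin

abbreviation "tableaux_to \<mu> \<nu> \<equiv> {T \<in> reverse_tableaux lam. apply_word \<mu> (row_word lam T) = \<nu>}"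
abbreviation "u_sub \<mu> \<equiv> \<lambda>T \<alpha>. int (val (T \<alpha>)) - int (apply_word \<mu> (row_word_upto lam T \<alpha>) (val (T \<alpha>)))"
abbreviation "v_sub \<equiv> \<lambda>T \<alpha>. int (val (T \<alpha>)) - box_content \<alpha>"

lemma finite_unbarred_boxes: "finite (unbarred_boxes lam T)"
  unfolding unbarred_boxes_def diagram_row by simp

text \<open>With bounded entries the formal sum is an ordinary finite one, given by
  \<open>sum_fillings\<close> at \<open>c = int e\<close>. Its numerator ends at
  \<open>int e + int n\<close>, that of \<open>pieri_coeff\<close> at \<open>int n\<close>.\<close>

lemma truncated_formal_sum:
  assumes le: "\<mu> \<le> \<nu>" and eq: "\<And>k. k \<notin> {1..n} \<Longrightarrow> \<mu> k = \<nu> k"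
  shows "has_formal_sum {T \<in> tableaux_to \<mu> \<nu>. \<forall>b\<in>diagram lam. val (T b) \<le> n}
    (unbarred_boxes lam) (u_sub \<mu>) v_sub
    (coeff_int (lin_prod avar (int e + 2 - int p) (int e + int n) * sites avar n \<mu> \<nu>) (int p - int (skew_size n \<mu> \<nu>)))"
proof -
  let ?S = "{T \<in> tableaux_to \<mu> \<nu>. \<forall>b\<in>diagram lam. val (T b) \<le> n}"
  have bij: "bij_betw (row_entries e p) ?S (fillings n \<mu> \<nu> p)"
    using bij_betw_row_entries[of \<mu> \<nu> n] by (simp add: conj_assoc)
  then have fin: "finite ?S" by (simp add: bij_betw_finite)
  have "(\<Sum>T\<in>?S. \<Prod>b\<in>unbarred_boxes lam T. avar (u_sub \<mu> T b) - avar (v_sub T b)) =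
      (\<Sum>T\<in>?S. weight avar \<mu> (int e) (row_entries e p T))"
    by (simp only: prod_unbarred_row)
  also have "\<dots> = (\<Sum>es\<in>fillings n \<mu> \<nu> p. weight avar \<mu> (int e) es)"
    by (rule sum.reindex_bij_betw[OF bij])
  also have "\<dots> = coeff_int (lin_prod avar (int e + 2 - int p) (int e + int n) * sites avar n \<mu> \<nu>) (int p - int (skew_size n \<mu> \<nu>))"
    by (rule sum_fillings[OF le eq])
  finally show ?thesis
    using has_formal_sum_finite[OF fin finite_unbarred_boxes] by simp
qed

text \<open>The largest entry sits in the first box. If it exceeds \<open>n\<close>, it is unbarred, and either choice
  in its factor puts a variable with index larger than \<open>n\<close> into the monomial.\<close>

lemma entries_bounded_by_monomial:
  assumes T: "T \<in> tableaux_to \<mu> \<nu>" and le: "\<mu> \<le> \<nu>" and zero: "\<And>k. k > n \<Longrightarrow> \<nu> k = 0"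
    and keys: "\<And>k. k \<in> Poly_Mapping.keys (choice_monom (u_sub \<mu> T) (v_sub T) (unbarred_boxes lam T) D) \<Longrightarrow> k \<le> int n"
    and b: "b \<in> diagram lam"
  shows "val (T b) \<le> n"
proof -
  let ?b = "(Suc e, Suc 0)"
  have first: "?b \<in> diagram lam" using p by (simp add: diagram_row)
  have "val (T ?b) \<le> n"
  proof (rule ccontr)
    assume large: "\<not> val (T ?b) \<le> n"
    show False
    proof (cases "T ?b")
      case (Unbarred v)
      then have mem: "?b \<in> unbarred_boxes lam T" using first by (simp add: unbarred_boxes_def)
      have "row_word_upto lam T ?b = []"
        using p Unbarred by (simp add: row_word_upto_row take_Suc_conv_app_nth)
      moreover have "\<mu> v = 0"
        using le zero[of v] large Unbarred by (auto simp: le_fun_def dest: spec[of _ v])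
      ultimately have "u_sub \<mu> T ?b = int v" "v_sub T ?b = int v + int e"
        using Unbarred by (simp_all add: box_content_def)
      then show False
        using keys[OF in_keys_choice_monom[OF finite_unbarred_boxes mem]] large Unbarred
        by (auto split: if_splits)
    next
      case (Barred v)
      \<comment> \<open>A barred \<open>v\<close> adds a box to row \<open>v\<close>, but rows
        beyond \<open>n\<close> are empty in \<open>\<nu>\<close>.\<close>
      then have "v \<in> set (row_word lam T)"
        using p nth_mem[of 0 "row_entries e p T"] unfolding row_word_row barred_entries_def
        by (auto intro!: rev_image_eqI[of "T ?b"])
      then have "\<nu> v \<noteq> 0"
        using T apply_word_count[of \<mu> "row_word lam T" v] by (auto simp: count_list_0_iff)
      then show False using zero[of v] large Barred by simp
    qed
  qed
  moreover obtain j where j: "b = (Suc e, Suc j)" "j < p"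
    using b by (cases "snd b") (auto simp: diagram_row)
  moreover have "val (T (Suc e, Suc j)) \<le> val (T ?b)"
    using T j sorted_wrt_nth_less[of _ "row_entries e p T" 0 j] by (cases j) (auto simp: reverse_tableaux_row)
  ultimately show ?thesis by simp
qed

text \<open>For each monomial \<open>m\<close> choose \<open>n\<close> beyond its indices. Then only
  tableaux with entries at most \<open>n\<close> contribute to \<open>m\<close>, and the surplus
  numerator factors of the truncated sum do not affect its coefficient.\<close>

lemma formal_sum_single_row:
  assumes strip: "strip \<mu> \<nu>" and nu: "is_composition \<nu>" and l: "len \<nu> \<le> n\<^sub>0"
    and c: "\<And>n. n\<^sub>0 \<le> n \<Longrightarrow> c = pieri_coeff avar (2 - int p + int e) n p \<mu> \<nu>"
  shows "has_formal_sum (tableaux_to \<mu> \<nu>) (unbarred_boxes lam) (u_sub \<mu>) v_sub c"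
  unfolding has_formal_sum_def Let_def
proof
  fix m :: "int \<Rightarrow>\<^sub>0 nat"
  have le: "\<mu> \<le> \<nu>" using strip by (simp add: strip_def)
  \<comment> \<open>The summand \<open>e\<close> keeps the lower numerator index
    \<open>int e + 2 - int p\<close> at most \<open>int n + 1\<close>.\<close>
  obtain n where n: "n\<^sub>0 + e \<le> n" "\<And>k. k \<in> Poly_Mapping.keys m \<Longrightarrow> k \<le> int n"
    by (rule exists_bound[where C = "{} :: nat set" and l = "n\<^sub>0 + e" and m = m]) auto
  have zero: "\<nu> k = 0" if "k > n" for k
    using composition_zero_beyond_len[OF nu] that l n(1) by simp
  have outside: "\<mu> k = \<nu> k" if "k \<notin> {1..n}" for k
  proof -
    have "\<nu> k = 0" using zero[of k] nu that by (cases "k = 0") (auto simp: is_composition_def)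
    moreover have "\<mu> k \<le> \<nu> k" using le by (simp add: le_fun_def)
    ultimately show ?thesis by simp
  qed
  define S where "S = {T \<in> tableaux_to \<mu> \<nu>. \<forall>b\<in>diagram lam. val (T b) \<le> n}"
  define X where "X = (\<lambda>S. {(T, D). T \<in> S \<and> D \<subseteq> unbarred_boxes lam T \<and>
    choice_monom (u_sub \<mu> T) (v_sub T) (unbarred_boxes lam T) D = m})"
  have "X (tableaux_to \<mu> \<nu>) = X S"
    using entries_bounded_by_monomial[OF _ le zero] n(2) by (fastforce simp: X_def S_def)
  moreover have "finite (X S) \<and> Poly_Mapping.lookup (coeff_int (lin_prod avar (int e + 2 - int p) (int e + int n) *
      sites avar n \<mu> \<nu>) (int p - int (skew_size n \<mu> \<nu>))) m = (\<Sum>(T, D)\<in>X S. (-1) ^ card D)"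
    using truncated_formal_sum[OF le outside] unfolding has_formal_sum_def Let_def S_def X_def by blast
  moreover have "Poly_Mapping.lookup (coeff_int (lin_prod avar (int e + 2 - int p) (int e + int n) *
      sites avar n \<mu> \<nu>) (int p - int (skew_size n \<mu> \<nu>))) m = Poly_Mapping.lookup c m"
  proof -
    have "c = coeff_int (lin_prod avar (int e + 2 - int p) (int n) * sites avar n \<mu> \<nu>) (int p - int (skew_size n \<mu> \<nu>))"
      using c[of n] n(1) by (simp add: pieri_coeff_def algebra_simps)
    then show ?thesis
      using lookup_coeff_int_lin_prod_extend[of "int e + 2 - int p" n m] n p by simp
  qed
  ultimately show "finite {(T, D). T \<in> tableaux_to \<mu> \<nu> \<and> D \<subseteq> unbarred_boxes lam T \<and>
      choice_monom (u_sub \<mu> T) (v_sub T) (unbarred_boxes lam T) D = m} \<and>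
    Poly_Mapping.lookup c m = (\<Sum>(T, D)\<in>{(T, D). T \<in> tableaux_to \<mu> \<nu> \<and> D \<subseteq> unbarred_boxes lam T \<and>
      choice_monom (u_sub \<mu> T) (v_sub T) (unbarred_boxes lam T) D = m}. (-1) ^ card D)"
    unfolding X_def by simp
qed

end

theorem proposition3p4:
  fixes \<mu> \<nu> lam :: "nat \<Rightarrow> nat" and p e :: nat
    and \<tau> :: "(nat \<Rightarrow> xpoly) \<Rightarrow> (nat \<Rightarrow> xpoly)"
    and c :: "(nat \<Rightarrow> nat) \<Rightarrow> apoly"
  assumes tau: "is_tau \<tau>"
    and mu: "is_partition \<mu>" and nu: "is_partition \<nu>"
    and p: "p \<ge> 1"
    and e: "1 \<le> e" "int e < int (len \<mu>) - 1"
    and lam_eq: "lam = (\<lambda>i. if i = e + 1 then p else 0)"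
    and c_finite: "finite {\<kappa>. c \<kappa> \<noteq> 0}"
    and c_partition: "\<And>\<kappa>. c \<kappa> \<noteq> 0 \<Longrightarrow> is_partition \<kappa>"
    and c_expansion: "h_shift \<tau> (int p) e * double_schur \<tau> \<mu> =
      (\<Sum>\<kappa> | c \<kappa> \<noteq> 0. scalar (c \<kappa>) * double_schur \<tau> \<kappa>)"
  shows "(\<not> \<mu> \<le> \<nu> \<longrightarrow> c \<nu> = 0) \<and>
    (\<mu> \<le> \<nu> \<longrightarrow>
      has_formal_sum
        {T \<in> reverse_tableaux lam. apply_word \<mu> (row_word lam T) = \<nu> \<and> yamanouchi \<mu> (row_word lam T)}
        (unbarred_boxes lam)
        (\<lambda>T \<alpha>. int (val (T \<alpha>)) - int (apply_word \<mu> (row_word_upto lam T \<alpha>) (val (T \<alpha>))))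
        (\<lambda>T \<alpha>. int (val (T \<alpha>)) - box_content \<alpha>)
        (c \<nu>))"
proof -
  interpret single_row lam p e by unfold_locales (fact p, fact lam_eq)
  have nu': "is_composition \<nu>" using nu by (simp add: is_partition_def)
  obtain n\<^sub>0 where n\<^sub>0: "Suc e + len \<mu> + len \<nu> \<le> n\<^sub>0" "\<And>\<kappa>. \<kappa> \<in> {\<kappa>. c \<kappa> \<noteq> 0} \<Longrightarrow> len \<kappa> \<le> n\<^sub>0"
    by (rule exists_bound[OF c_finite, where l = "Suc e + len \<mu> + len \<nu>" and f = len and m = 0]) auto
  \<comment> \<open>The formula is kept for every large \<open>n\<close>, since the choice of
    \<open>n\<close> will depend on the monomial.\<close>
  have c: "c \<nu> = (if strip \<mu> \<nu> then pieri_coeff avar (2 - int p + int e) n p \<mu> \<nu> else 0)" if "n\<^sub>0 \<le> n" for n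
    by (rule coefficient_eq[OF tau mu nu c_finite c_partition c_expansion])
      (use n\<^sub>0 that in \<open>auto intro: order_trans\<close>)
  let ?S = "{T \<in> reverse_tableaux lam. apply_word \<mu> (row_word lam T) = \<nu> \<and> yamanouchi \<mu> (row_word lam T)}"
  show ?thesis
  \<comment> \<open>Failure of \<open>strip\<close> includes
    \<open>\<not> \<mu> \<le> \<nu>\<close>; then the coefficient is 0 and no tableau
    qualifies.\<close>
  proof (cases "strip \<mu> \<nu>")
    case True
    then have "?S = tableaux_to \<mu> \<nu>"
      using strip_imp_yamanouchi[OF mu nu] by blast
    moreover have "has_formal_sum (tableaux_to \<mu> \<nu>) (unbarred_boxes lam) (u_sub \<mu>) v_sub (c \<nu>)"
      by (rule formal_sum_single_row[OF True nu', of n\<^sub>0]) (use c True n\<^sub>0 in auto)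
    ultimately show ?thesis using True by (simp add: strip_def)
  next
    case False
    then have empty: "?S = {}"
      using yamanouchi_imp_strip[OF _ sorted_row_word] by blast
    have zero: "c \<nu> = 0" using c[of n\<^sub>0] False by simp
    have "has_formal_sum {} (unbarred_boxes lam) (u_sub \<mu>) v_sub 0"
      by (subst has_formal_sum_finite) auto
    then show ?thesis unfolding empty zero by simp
  qed
qed

end
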